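(* Let $S$ be a smooth surface locally parametrized by $\alpha(u,v)=(u,v,h(u,v))$ with $$h(u,v)=\tfrac12(u^2+\varepsilon v^2)+\tfrac16\sigma(u^3-3\varepsilon uv^2)+O(4),\qquad \varepsilon\in\{1,-1\},\ \sigma\in\mathbb{R},$$ where $O(4)$ denotes arbitrary smooth terms of order at least four (Pick normal form at a point that is not Euclidean parabolic), and let $p=\alpha(0,0)$ be a flat affine umbilic point of $S$. Then by a change of coordinates the binary differential equation of the affine asymptotic lines can be written as $$\bigl(-\varepsilon_1 v+O(2)\bigr)\,du^2+\bigl(-2\varepsilon_1 u+O(2)\bigr)\,du\,dv+\bigl(v+O(2)\bigr)\,dv^2=0,$$ where $\varepsilon_1=\pm1$.
   Context: For an immersion $\alpha$ put $L=\det(\alpha_u,\alpha_v,\alpha_{uu})$, $M=\det(\alpha_u,\alpha_v,\alpha_{uv})$, $N=\det(\alpha_u,\alpha_v,\alpha_{vv})$. A point is Euclidean parabolic if $LN-M^2=0$. At non-parabolic points the co-normal is $\nu=|LN-M^2|^{-1/4}(\alpha_u\wedge\alpha_v)$ and the affine normal $\xi$ is determined by $\langle\nu,\xi\rangle=1$, $\langle\xi,\nu_u\rangle=\langle\xi,\nu_v\rangle=0$; $D\xi$ maps $T_pS$ to itself (affine shape operator). Put $l=\langle\nu_u,\xi_u\rangle$, $m=\langle\nu_u,\xi_v\rangle$, $n=\langle\nu_v,\xi_v\rangle$. The affine asymptotic lines are the integral curves of $l\,du^2+2m\,du\,dv+n\,dv^2=0$. An affine umbilic point is a point where the affine shape operator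 is a multiple of the identity. An affine parabolic point is one where $\det D\xi=0$, equivalently $ln-m^2=0$. A flat affine umbilic point is one that is simultaneously affine umbilic and affine parabolic; at such a point $l=m=n=0$. $O(2)$ denotes terms of order at least two in $(u,v)$.
   Formalization: Added assumption: ln − m² has a nondegenerate critical point at p. Without it the claim fails, e.g. for the quadric h = (u²+εv²)/2, where l = m = n = 0 identically; the condition is also necessary for the stated form. *)

theory Defs
  imports "HOL-Analysis.Analysis" "HOL-Library.Landau_Symbols"
begin

text \<open>The parameter plane is \<^typ>\<open>real^2\<close>, with \<open>u = x $ 1\<close> and \<open>v = x $ 2\<close>.\<close>

primrec Ck_on :: "nat \<Rightarrow> ('a::real_normed_vector \<Rightarrow> 'b::real_normed_vector) \<Rightarrow> 'a set \<Rightarrow> bool" where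
  "Ck_on 0 f U \<longleftrightarrow> continuous_on U f"
| "Ck_on (Suc k) f U \<longleftrightarrow>
     (\<forall>x\<in>U. f differentiable (at x)) \<and> (\<forall>w. Ck_on k (\<lambda>x. frechet_derivative f (at x) w) U)"

definition smooth_on :: "('a::real_normed_vector \<Rightarrow> 'b::real_normed_vector) \<Rightarrow> 'a set \<Rightarrow> bool" where
  "smooth_on f U \<longleftrightarrow> (\<forall>k. Ck_on k f U)"

text \<open>A smooth \<open>O(k)\<close> remainder at the origin. By Taylor's theorem the growth condition says that
  all partial derivatives of order less than \<open>k\<close> vanish there.\<close>

definition terms_of_order :: "nat \<Rightarrow> (real^2) set \<Rightarrow> (real^2 \<Rightarrow> real) \<Rightarrow> bool" where
  "terms_of_order k U R \<longleftrightarrow> smooth_on R U \<and> R \<in> O[nhds 0](\<lambda>x. norm x ^ k)"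

definition pd_u :: "(real^2 \<Rightarrow> 'a::real_normed_vector) \<Rightarrow> real^2 \<Rightarrow> 'a" where
  "pd_u f x = frechet_derivative f (at x) (axis 1 1)"

definition pd_v :: "(real^2 \<Rightarrow> 'a::real_normed_vector) \<Rightarrow> real^2 \<Rightarrow> 'a" where
  "pd_v f x = frechet_derivative f (at x) (axis 2 1)"

definition graph_immersion :: "(real^2 \<Rightarrow> real) \<Rightarrow> real^2 \<Rightarrow> real^3" where
  "graph_immersion h x = vector [x $ 1, x $ 2, h x]"

definition coef_L :: "(real^2 \<Rightarrow> real^3) \<Rightarrow> real^2 \<Rightarrow> real" where
  "coef_L \<alpha> x = det (vector [pd_u \<alpha> x, pd_v \<alpha> x, pd_u (pd_u \<alpha>) x] :: real^3^3)"

definition coef_M :: "(real^2 \<Rightarrow> real^3) \<Rightarrow> real^2 \<Rightarrow> real" where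
  "coef_M \<alpha> x = det (vector [pd_u \<alpha> x, pd_v \<alpha> x, pd_v (pd_u \<alpha>) x] :: real^3^3)"

definition coef_N :: "(real^2 \<Rightarrow> real^3) \<Rightarrow> real^2 \<Rightarrow> real" where
  "coef_N \<alpha> x = det (vector [pd_u \<alpha> x, pd_v \<alpha> x, pd_v (pd_v \<alpha>) x] :: real^3^3)"

definition conormal :: "(real^2 \<Rightarrow> real^3) \<Rightarrow> real^2 \<Rightarrow> real^3" where
  "conormal \<alpha> x =
     (\<bar>coef_L \<alpha> x * coef_N \<alpha> x - (coef_M \<alpha> x)\<^sup>2\<bar> powr (-1/4)) *\<^sub>R cross3 (pd_u \<alpha> x) (pd_v \<alpha> x)"

text \<open>The description below has exactly one solution when \<open>x\<close> is not Euclidean parabolic; at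
  Euclidean parabolic points the value is meaningless.\<close>

definition affine_normal :: "(real^2 \<Rightarrow> real^3) \<Rightarrow> real^2 \<Rightarrow> real^3" where
  "affine_normal \<alpha> x = (THE \<xi>. conormal \<alpha> x \<bullet> \<xi> = 1 \<and>
     \<xi> \<bullet> pd_u (conormal \<alpha>) x = 0 \<and> \<xi> \<bullet> pd_v (conormal \<alpha>) x = 0)"

text \<open>The affine shape operator is the endomorphism \<open>D\<alpha>(w) \<mapsto> D\<xi>(w)\<close> of the tangent plane
  \<open>range (D\<alpha>)\<close>; it is represented by its matrix in the basis \<open>(\<alpha>\<^sub>u, \<alpha>\<^sub>v)\<close>, which is unique since
  \<open>\<alpha>\<close> is an immersion. Being a multiple of the identity and having zero determinant do
  not depend on the basis.\<close>

definition affine_shape_matrix :: "(real^2 \<Rightarrow> real^3) \<Rightarrow> real^2 \<Rightarrow> real^2^2 \<Rightarrow> bool" where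
  "affine_shape_matrix \<alpha> x A \<longleftrightarrow>
     (\<forall>w. frechet_derivative (affine_normal \<alpha>) (at x) w = frechet_derivative \<alpha> (at x) (A *v w))"

definition affine_umbilic :: "(real^2 \<Rightarrow> real^3) \<Rightarrow> real^2 \<Rightarrow> bool" where
  "affine_umbilic \<alpha> x \<longleftrightarrow> (\<exists>c. affine_shape_matrix \<alpha> x (mat c))"

definition affine_parabolic :: "(real^2 \<Rightarrow> real^3) \<Rightarrow> real^2 \<Rightarrow> bool" where
  "affine_parabolic \<alpha> x \<longleftrightarrow> (\<exists>A. affine_shape_matrix \<alpha> x A \<and> det A = 0)"

definition flat_affine_umbilic :: "(real^2 \<Rightarrow> real^3) \<Rightarrow> real^2 \<Rightarrow> bool" where
  "flat_affine_umbilic \<alpha> x \<longleftrightarrow> affine_umbilic \<alpha> x \<and> affine_parabolic \<alpha> x"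

definition coef_l :: "(real^2 \<Rightarrow> real^3) \<Rightarrow> real^2 \<Rightarrow> real" where
  "coef_l \<alpha> x = pd_u (conormal \<alpha>) x \<bullet> pd_u (affine_normal \<alpha>) x"

definition coef_m :: "(real^2 \<Rightarrow> real^3) \<Rightarrow> real^2 \<Rightarrow> real" where
  "coef_m \<alpha> x = pd_u (conormal \<alpha>) x \<bullet> pd_v (affine_normal \<alpha>) x"

definition coef_n :: "(real^2 \<Rightarrow> real^3) \<Rightarrow> real^2 \<Rightarrow> real" where
  "coef_n \<alpha> x = pd_v (conormal \<alpha>) x \<bullet> pd_v (affine_normal \<alpha>) x"

text \<open>A binary differential equation \<open>a du\<^sup>2 + b du dv + c dv\<^sup>2 = 0\<close> is given by the quadratic
  differential form on its left-hand side, a function of a point \<open>x\<close> and a tangent vector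
  \<open>w = (du, dv)\<close>; a change of coordinates acts on it by pullback.\<close>

definition bde_form ::
  "(real^2 \<Rightarrow> real) \<Rightarrow> (real^2 \<Rightarrow> real) \<Rightarrow> (real^2 \<Rightarrow> real) \<Rightarrow> real^2 \<Rightarrow> real^2 \<Rightarrow> real" where
  "bde_form a b c x w = a x * (w $ 1)\<^sup>2 + b x * w $ 1 * w $ 2 + c x * (w $ 2)\<^sup>2"

definition affine_asymptotic_form :: "(real^2 \<Rightarrow> real^3) \<Rightarrow> real^2 \<Rightarrow> real^2 \<Rightarrow> real" where
  "affine_asymptotic_form \<alpha> = bde_form (coef_l \<alpha>) (\<lambda>x. 2 * coef_m \<alpha> x) (coef_n \<alpha>)"

definition coordinate_change :: "(real^2) set \<Rightarrow> (real^2) set \<Rightarrow> (real^2 \<Rightarrow> real^2) \<Rightarrow> bool" where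
  "coordinate_change V W \<phi> \<longleftrightarrow> open V \<and> open W \<and> bij_betw \<phi> V W \<and>
     smooth_on \<phi> V \<and> smooth_on (inv_into V \<phi>) W"

definition pullback_form ::
  "(real^2 \<Rightarrow> real^2) \<Rightarrow> (real^2 \<Rightarrow> real^2 \<Rightarrow> real) \<Rightarrow> real^2 \<Rightarrow> real^2 \<Rightarrow> real" where
  "pullback_form \<phi> \<omega> x w = \<omega> (\<phi> x) (frechet_derivative \<phi> (at x) w)"

definition nondegenerate_critical_point :: "(real^2 \<Rightarrow> real) \<Rightarrow> real^2 \<Rightarrow> bool" where
  "nondegenerate_critical_point f x \<longleftrightarrow> pd_u f x = 0 \<and> pd_v f x = 0 \<and>
     pd_u (pd_u f) x * pd_v (pd_v f) x - (pd_v (pd_u f) x)\<^sup>2 \<noteq> 0"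

text \<open>The zero set of this function is the affine parabolic set. At a flat affine umbilic point the
  1-jet of \<open>(l, m, n)\<close> consists of the second derivatives of a binary cubic form, and the 2-jet
  of \<open>ln - m\<^sup>2\<close> is the Hessian determinant of that cubic, which is nondegenerate exactly when the
  cubic has no repeated factor. This is a genericity condition: it fails, for instance, on quadrics,
  where \<open>l\<close>, \<open>m\<close>, \<open>n\<close> vanish identically.\<close>

definition affine_parabolic_function :: "(real^2 \<Rightarrow> real^3) \<Rightarrow> real^2 \<Rightarrow> real" where
  "affine_parabolic_function \<alpha> x = coef_l \<alpha> x * coef_n \<alpha> x - (coef_m \<alpha> x)\<^sup>2"

end

theory Submission
  imports Defs
begin

text \<open>Differentiating \<open>\<langle>\<nu>\<^sub>u, \<xi>\<rangle> = \<langle>\<nu>\<^sub>v, \<xi>\<rangle> = 0\<close> gives \<open>l = - \<langle>\<nu>\<^sub>u\<^sub>u, \<xi>\<rangle>\<close>, \<open>m = - \<langle>\<nu>\<^sub>u\<^sub>v, \<xi>\<rangle>\<close>,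
  \<open>n = - \<langle>\<nu>\<^sub>v\<^sub>v, \<xi>\<rangle>\<close>. At a flat affine umbilic point \<open>D\<xi> = 0\<close>, so the first derivatives of
  \<open>l\<close>, \<open>m\<close>, \<open>n\<close> there are \<open>- \<langle>D\<^sup>3\<nu>, \<xi>\<rangle>\<close>, a symmetric trilinear form: the linear part of the equation
  is the Hessian of a binary cubic form. Nondegeneracy of \<open>ln - m\<^sup>2\<close> says that this cubic
  has no repeated factor, hence a linear change of coordinates brings it to a multiple
  of \<open>v\<^sup>3 - 3\<epsilon>\<^sub>1u\<^sup>2v\<close>.\<close>

section \<open>Smooth functions\<close>

text \<open>Let \<open>T\<close> be the symmetric trilinear form behind the cubic. At the point
  \<open>x\<close> and on the vector \<open>w\<close>, the linear part of the equation is
  \<open>T(x, w, w)\<close>. A linear substitution \<open>P\<close> turns this into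
  \<open>T(P x, P w, P w)\<close>: point and tangent vector move together, so normalising the cubic
  normalises the equation. A real cubic has a real linear factor. Once that factor is
  \<open>v\<close>, completing the square in the remaining quadratic factor and rescaling leave one
  sign: \<open>\<epsilon>\<^sub>1 = 1\<close> for three real linear factors,
  \<open>\<epsilon>\<^sub>1 = -1\<close> for one. The normal form of \<open>h\<close> gives the
  Hessian determinant the value \<open>\<epsilon>\<close> at the origin. It is therefore nonzero
  nearby, and there the conormal and the affine normal are smooth. Smoothness is a recursion over
  directional derivatives, so closure rules and the symmetry of iterated derivatives are derived for
  this notion.\<close>

definition dir_deriv :: "'a \<Rightarrow> ('a::real_normed_vector \<Rightarrow> 'b::real_normed_vector) \<Rightarrow> 'a \<Rightarrow> 'b" where
  "dir_deriv w f x = frechet_derivative f (at x) w"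

lemma pd_u_eq_dir_deriv: "pd_u f = dir_deriv (axis 1 1) f"
  and pd_v_eq_dir_deriv: "pd_v f = dir_deriv (axis 2 1) f"
  by (simp_all add: fun_eq_iff pd_u_def pd_v_def dir_deriv_def)

lemma has_derivative_dir_deriv:
  "f differentiable (at x) \<Longrightarrow> (f has_derivative (\<lambda>w. dir_deriv w f x)) (at x)"
  by (simp add: dir_deriv_def frechet_derivative_works[symmetric])

lemma dir_deriv_eq: "(f has_derivative f') (at x) \<Longrightarrow> dir_deriv w f x = f' w"
  by (metis dir_deriv_def frechet_derivative_at)

lemma linear_dir_deriv: "f differentiable (at x) \<Longrightarrow> linear (\<lambda>w. dir_deriv w f x)"
  unfolding dir_deriv_def using linear_frechet_derivative by blast

lemma dir_deriv_cong:
  assumes "f differentiable (at x)" "open U" "x \<in> U" "\<And>y. y \<in> U \<Longrightarrow> f y = g y"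
  shows "dir_deriv w f x = dir_deriv w g x"
  unfolding dir_deriv_def using frechet_derivative_transform_within_open[OF assms] by simp

lemma differentiable_cong_open:
  assumes "f differentiable (at x)" "open U" "x \<in> U" "\<And>y. y \<in> U \<Longrightarrow> f y = g y"
  shows "g differentiable (at x)"
  using assms by (metis differentiable_def has_derivative_transform_within_open)

text \<open>A directional derivative is again a function of the point, so the recursion can be
  iterated in this form. The unfolding through \<open>frechet_derivative\<close> leaves the simpset
  in its favour.\<close>

lemma Ck_on_Suc_iff:
  "Ck_on (Suc k) f U \<longleftrightarrow> (\<forall>x\<in>U. f differentiable (at x)) \<and> (\<forall>w. Ck_on k (dir_deriv w f) U)"
  by (simp add: dir_deriv_def[abs_def])

declare Ck_on.simps(2) [simp del]

text \<open>Derivative formulas hold only on \<open>U\<close>, and openness makes agreement on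
  \<open>U\<close> enough at every level. The closure lemmas use this to pass from an explicit
  formula to \<open>dir_deriv\<close> itself.\<close>

lemma Ck_on_cong:
  assumes "open U" "\<And>x. x \<in> U \<Longrightarrow> f x = g x" "Ck_on k f U"
  shows "Ck_on k g U"
  using assms(2,3)
proof (induction k arbitrary: f g)
  case 0
  then show ?case by (simp cong: continuous_on_cong)
next
  case (Suc k)
  have d: "f differentiable (at x)" if "x \<in> U" for x
    using Suc.prems(2) that by (simp add: Ck_on_Suc_iff)
  have "g differentiable (at x)" if "x \<in> U" for x
    using differentiable_cong_open[OF d[OF that] assms(1) that] Suc.prems(1) by blast
  moreover have "Ck_on k (dir_deriv w g) U" for w
    by (rule Suc.IH[of "dir_deriv w f"])
      (use Suc.prems assms(1) dir_deriv_cong[OF d] in \<open>auto simp: Ck_on_Suc_iff\<close>)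
  ultimately show ?case by (simp add: Ck_on_Suc_iff)
qed

text \<open>Continuity is demanded only at the bottom of the recursion, so lowering the order rests
  on differentiable functions being continuous.\<close>

lemma Ck_on_SucD: "Ck_on (Suc k) f U \<Longrightarrow> Ck_on k f U"
proof (induction k arbitrary: f)
  case 0
  then show ?case
    by (auto simp: Ck_on_Suc_iff intro!: differentiable_imp_continuous_on differentiable_at_imp_differentiable_on)
next
  case (Suc k)
  then show ?case by (metis Ck_on_Suc_iff)
qed

lemma Ck_on_subset: "Ck_on k f U \<Longrightarrow> V \<subseteq> U \<Longrightarrow> Ck_on k f V"
  by (induction k arbitrary: f) (auto simp: Ck_on_Suc_iff intro: continuous_on_subset)

lemma Ck_on_add:
  assumes "open U" "Ck_on k f U" "Ck_on k g U"
  shows "Ck_on k (\<lambda>x. f x + g x) U"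
  using assms(2,3)
proof (induction k arbitrary: f g)
  case 0
  then show ?case by (simp add: continuous_on_add)
next
  case (Suc k)
  have d: "dir_deriv w f x + dir_deriv w g x = dir_deriv w (\<lambda>x. f x + g x) x" if "x \<in> U" for x w
    using Suc.prems that
    by (intro dir_deriv_eq[symmetric] has_derivative_add has_derivative_dir_deriv)
      (auto simp: Ck_on_Suc_iff)
  have "Ck_on k (dir_deriv w (\<lambda>x. f x + g x)) U" for w
    by (rule Ck_on_cong[OF assms(1) d Suc.IH]) (use Suc.prems in \<open>auto simp: Ck_on_Suc_iff\<close>)
  then show ?case using Suc.prems by (simp add: Ck_on_Suc_iff differentiable_add)
qed

lemma Ck_on_bounded_linear:
  assumes "open U" "bounded_linear L" "Ck_on k f U"
  shows "Ck_on k (\<lambda>x. L (f x)) U"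
  using assms(3)
proof (induction k arbitrary: f)
  case 0
  then show ?case by (simp add: bounded_linear.continuous_on[OF assms(2)])
next
  case (Suc k)
  have h: "((\<lambda>x. L (f x)) has_derivative (\<lambda>w. L (dir_deriv w f x))) (at x)" if "x \<in> U" for x
    using Suc.prems that
    by (intro bounded_linear.has_derivative[OF assms(2)] has_derivative_dir_deriv)
      (auto simp: Ck_on_Suc_iff)
  have "Ck_on k (dir_deriv w (\<lambda>x. L (f x))) U" for w
    by (rule Ck_on_cong[OF assms(1) dir_deriv_eq[OF h, symmetric] Suc.IH])
      (use Suc.prems in \<open>auto simp: Ck_on_Suc_iff\<close>)
  then show ?case using h by (auto simp: Ck_on_Suc_iff differentiable_def)
qed

text \<open>One Leibniz rule serves products, scalar multiples, inner products and cross products.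
  Each summand keeps one factor undifferentiated, whose order must first be lowered by one.\<close>

lemma Ck_on_bounded_bilinear:
  assumes "open U" "bounded_bilinear B" "Ck_on k f U" "Ck_on k g U"
  shows "Ck_on k (\<lambda>x. B (f x) (g x)) U"
  using assms(3,4)
proof (induction k arbitrary: f g)
  case 0
  then show ?case by (simp add: bounded_bilinear.continuous_on[OF assms(2)])
next
  case (Suc k)
  have h: "((\<lambda>x. B (f x) (g x)) has_derivative
      (\<lambda>w. B (f x) (dir_deriv w g x) + B (dir_deriv w f x) (g x))) (at x)" if "x \<in> U" for x
    using Suc.prems that
    by (intro bounded_bilinear.FDERIV[OF assms(2)] has_derivative_dir_deriv)
      (auto simp: Ck_on_Suc_iff)
  have "Ck_on k (dir_deriv w (\<lambda>x. B (f x) (g x))) U" for w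
    by (rule Ck_on_cong[OF assms(1) dir_deriv_eq[OF h, symmetric] Ck_on_add[OF assms(1) Suc.IH Suc.IH]])
      (use Suc.prems in \<open>auto simp: Ck_on_Suc_iff intro: Ck_on_SucD[unfolded Ck_on_Suc_iff]\<close>)
  then show ?case using h by (auto simp: Ck_on_Suc_iff differentiable_def)
qed

lemma Ck_on_const: "Ck_on k (\<lambda>x. c) U"
proof (induction k arbitrary: c)
  case (Suc k)
  have "dir_deriv w (\<lambda>x::'a. c) = (\<lambda>x. 0)" for w
    by (simp add: fun_eq_iff dir_deriv_def)
  with Suc show ?case by (simp add: Ck_on_Suc_iff)
qed simp

text \<open>For linear \<open>P\<close> the derivative along \<open>w\<close> is the derivative of
  \<open>f\<close> along \<open>P w\<close>, composed with the same \<open>P\<close>. The induction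
  closes by varying \<open>f\<close> alone; this suffices because the coordinate change will be
  linear.\<close>

lemma Ck_on_compose_linear:
  assumes "open V" "bounded_linear P" "P ` V \<subseteq> U" "Ck_on k f U"
  shows "Ck_on k (\<lambda>x. f (P x)) V"
  using assms(4)
proof (induction k arbitrary: f)
  case 0
  then show ?case
    using continuous_on_compose2[OF _ linear_continuous_on[OF assms(2)] assms(3), of f] by simp
next
  case (Suc k)
  have h: "((\<lambda>x. f (P x)) has_derivative (\<lambda>w. dir_deriv (P w) f (P x))) (at x)" if "x \<in> V" for x
    using Suc.prems that assms(2,3)
    by (intro has_derivative_compose[OF bounded_linear_imp_has_derivative[OF assms(2)]]
        has_derivative_dir_deriv) (auto simp: Ck_on_Suc_iff)
  have "Ck_on k (dir_deriv w (\<lambda>x. f (P x))) V" for w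
    by (rule Ck_on_cong[OF assms(1) dir_deriv_eq[OF h, symmetric] Suc.IH[of "dir_deriv (P w) f"]])
      (use Suc.prems in \<open>auto simp: Ck_on_Suc_iff\<close>)
  then show ?case using h by (auto simp: Ck_on_Suc_iff differentiable_def)
qed

text \<open>The derivative of a reciprocal contains the same reciprocal, so the induction hypothesis
  is needed for \<open>f\<close> itself and \<open>f\<close> stays fixed.\<close>

lemma Ck_on_inverse:
  fixes f :: "'a::real_normed_vector \<Rightarrow> real"
  assumes "open U" "\<And>x. x \<in> U \<Longrightarrow> f x \<noteq> 0" "Ck_on k f U"
  shows "Ck_on k (\<lambda>x. inverse (f x)) U"
  using assms(3)
proof (induction k)
  case 0
  then show ?case using assms(2) by (simp add: continuous_on_inverse)
next
  case (Suc k)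
  have h: "((\<lambda>x. inverse (f x)) has_derivative
      (\<lambda>w. - (inverse (f x) * dir_deriv w f x * inverse (f x)))) (at x)" if "x \<in> U" for x
    using Suc.prems that
    by (intro Deriv.has_derivative_inverse assms(2) has_derivative_dir_deriv)
      (auto simp: Ck_on_Suc_iff)
  have i: "Ck_on k (\<lambda>x. inverse (f x)) U" using Suc.IH[OF Ck_on_SucD[OF Suc.prems]] .
  have "Ck_on k (\<lambda>x. - (inverse (f x) * dir_deriv w f x * inverse (f x))) U" for w
    using Suc.prems i
    by (intro Ck_on_bounded_linear[OF assms(1) bounded_linear_minus[OF bounded_linear_ident]]
        Ck_on_bounded_bilinear[OF assms(1) bounded_bilinear_mult])
      (auto simp: Ck_on_Suc_iff)
  then have "Ck_on k (dir_deriv w (\<lambda>x. inverse (f x))) U" for w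
    using Ck_on_cong[OF assms(1), of "\<lambda>x. - (inverse (f x) * dir_deriv w f x * inverse (f x))"] dir_deriv_eq[OF h] by simp
  then show ?case using h by (auto simp: Ck_on_Suc_iff differentiable_def)
qed

text \<open>With exponent -1/4 this is the normalising factor of the conormal; the Hessian
  determinant may have either sign.\<close>

lemma Ck_on_abs_powr:
  fixes f :: "'a::real_normed_vector \<Rightarrow> real"
  assumes "open U" "\<And>x. x \<in> U \<Longrightarrow> f x \<noteq> 0" "Ck_on k f U"
  shows "Ck_on k (\<lambda>x. \<bar>f x\<bar> powr a) U"
  using assms(3)
proof (induction k)
  case 0
  then show ?case using assms(2) by (auto intro!: continuous_intros)
next
  case (Suc k)
  \<comment> \<open>Dividing by \<open>y\<close> instead of lowering the exponent gives one formula
    for both signs of \<open>y\<close> and keeps the exponent \<open>a\<close>, so that the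
    induction hypothesis applies.\<close>
  have g: "((\<lambda>y. \<bar>y\<bar> powr a) has_real_derivative a * \<bar>y\<bar> powr a * inverse y) (at y)"
    if "y \<noteq> 0" for y :: real
  proof (cases "y > 0")
    case True
    have "((\<lambda>y. y powr a) has_real_derivative a * y powr (a - 1)) (at y)"
      using True by (rule has_real_derivative_powr)
    moreover have "a * y powr (a - 1) = a * \<bar>y\<bar> powr a * inverse y"
      using True by (simp add: powr_diff divide_inverse)
    ultimately have "((\<lambda>y. y powr a) has_real_derivative a * \<bar>y\<bar> powr a * inverse y) (at y)"
      by simp
    then show ?thesis
      by (rule has_field_derivative_transform_within_open[where S = "{0<..}"]) (use True in auto)
  next
    case False
    then have "- y > 0" using that by simp
    then have "((\<lambda>y. (- y) powr a) has_real_derivative a * (- y) powr (a - 1) * - 1) (at y)"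
      by (auto intro!: derivative_eq_intros)
    moreover have "a * (- y) powr (a - 1) * - 1 = a * \<bar>y\<bar> powr a * inverse y"
      using \<open>- y > 0\<close> by (simp add: powr_diff divide_inverse)
    ultimately have "((\<lambda>y. (- y) powr a) has_real_derivative a * \<bar>y\<bar> powr a * inverse y) (at y)"
      by simp
    then show ?thesis
      by (rule has_field_derivative_transform_within_open[where S = "{..<0}"])
        (use \<open>- y > 0\<close> in auto)
  qed
  have h: "((\<lambda>x. \<bar>f x\<bar> powr a) has_derivative
      (\<lambda>w. dir_deriv w f x * (a * \<bar>f x\<bar> powr a * inverse (f x)))) (at x)" if "x \<in> U" for x
    using Suc.prems that
    by (intro DERIV_compose_FDERIV[where f = "\<lambda>y. \<bar>y\<bar> powr a" and g = f] g assms(2) has_derivative_dir_deriv)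
      (auto simp: Ck_on_Suc_iff)
  have i: "Ck_on k (\<lambda>x. \<bar>f x\<bar> powr a) U" "Ck_on k (\<lambda>x. inverse (f x)) U"
    using Suc.IH Ck_on_inverse[OF assms(1,2) Ck_on_SucD[OF Suc.prems]] Ck_on_SucD[OF Suc.prems]
    by blast+
  have "Ck_on k (\<lambda>x. dir_deriv w f x * (a * \<bar>f x\<bar> powr a * inverse (f x))) U" for w
    using Suc.prems i
    by (intro Ck_on_bounded_bilinear[OF assms(1) bounded_bilinear_mult] Ck_on_const)
      (auto simp: Ck_on_Suc_iff)
  then have "Ck_on k (dir_deriv w (\<lambda>x. \<bar>f x\<bar> powr a)) U" for w
    using Ck_on_cong[OF assms(1), of "\<lambda>x. dir_deriv w f x * (a * \<bar>f x\<bar> powr a * inverse (f x))"] dir_deriv_eq[OF h] by simp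
  then show ?case using h by (auto simp: Ck_on_Suc_iff differentiable_def)
qed

section \<open>Closure rules at infinite order\<close>

lemma smooth_on_imp_differentiable: "smooth_on f U \<Longrightarrow> x \<in> U \<Longrightarrow> f differentiable (at x)"
  unfolding smooth_on_def by (metis Ck_on_Suc_iff)

lemma smooth_on_imp_continuous_on: "smooth_on f U \<Longrightarrow> continuous_on U f"
  unfolding smooth_on_def by (metis Ck_on.simps(1))

lemma smooth_on_dir_deriv: "smooth_on f U \<Longrightarrow> smooth_on (dir_deriv w f) U"
  unfolding smooth_on_def by (metis Ck_on_Suc_iff)

lemma smooth_on_pd:
  assumes "smooth_on f U"
  shows "smooth_on (pd_u f) U" "smooth_on (pd_v f) U"
  using assms by (simp_all add: pd_u_eq_dir_deriv pd_v_eq_dir_deriv smooth_on_dir_deriv)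

lemma smooth_on_cong:
  "open U \<Longrightarrow> (\<And>x. x \<in> U \<Longrightarrow> f x = g x) \<Longrightarrow> smooth_on f U \<Longrightarrow> smooth_on g U"
  unfolding smooth_on_def using Ck_on_cong by blast

lemma smooth_on_subset: "smooth_on f U \<Longrightarrow> V \<subseteq> U \<Longrightarrow> smooth_on f V"
  unfolding smooth_on_def using Ck_on_subset by blast

lemma smooth_on_const: "smooth_on (\<lambda>x. c) U"
  by (simp add: smooth_on_def Ck_on_const)

lemma smooth_on_add:
  "open U \<Longrightarrow> smooth_on f U \<Longrightarrow> smooth_on g U \<Longrightarrow> smooth_on (\<lambda>x. f x + g x) U"
  by (simp add: smooth_on_def Ck_on_add)

lemma smooth_on_bounded_linear:
  "open U \<Longrightarrow> bounded_linear L \<Longrightarrow> smooth_on f U \<Longrightarrow> smooth_on (\<lambda>x. L (f x)) U"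
  by (simp add: smooth_on_def Ck_on_bounded_linear)

lemma smooth_on_bounded_bilinear:
  "open U \<Longrightarrow> bounded_bilinear B \<Longrightarrow> smooth_on f U \<Longrightarrow> smooth_on g U \<Longrightarrow> smooth_on (\<lambda>x. B (f x) (g x)) U"
  by (simp add: smooth_on_def Ck_on_bounded_bilinear)

lemma smooth_on_compose_linear:
  "open V \<Longrightarrow> bounded_linear P \<Longrightarrow> P ` V \<subseteq> U \<Longrightarrow> smooth_on f U \<Longrightarrow> smooth_on (\<lambda>x. f (P x)) V"
  by (simp add: smooth_on_def Ck_on_compose_linear)

lemma smooth_on_inverse:
  fixes f :: "'a::real_normed_vector \<Rightarrow> real"
  shows "open U \<Longrightarrow> (\<And>x. x \<in> U \<Longrightarrow> f x \<noteq> 0) \<Longrightarrow> smooth_on f U \<Longrightarrow> smooth_on (\<lambda>x. inverse (f x)) U"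
  by (simp add: smooth_on_def Ck_on_inverse)

lemma smooth_on_abs_powr:
  fixes f :: "'a::real_normed_vector \<Rightarrow> real"
  shows "open U \<Longrightarrow> (\<And>x. x \<in> U \<Longrightarrow> f x \<noteq> 0) \<Longrightarrow> smooth_on f U \<Longrightarrow> smooth_on (\<lambda>x. \<bar>f x\<bar> powr a) U"
  by (simp add: smooth_on_def Ck_on_abs_powr)

lemma smooth_on_ident: "open U \<Longrightarrow> smooth_on (\<lambda>x. x) U"
proof -
  assume "open U"
  have "Ck_on k (\<lambda>x. x) U" for k
  proof (cases k)
    case (Suc n)
    have "dir_deriv w (\<lambda>x::'a. x) = (\<lambda>x. w)" for w
      by (simp add: fun_eq_iff dir_deriv_def)
    with Suc show ?thesis by (simp add: Ck_on_Suc_iff Ck_on_const)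
  qed simp
  then show ?thesis by (simp add: smooth_on_def)
qed

lemma smooth_on_linear: "open U \<Longrightarrow> bounded_linear L \<Longrightarrow> smooth_on L U"
  using smooth_on_bounded_linear[OF _ _ smooth_on_ident] by blast

lemma smooth_on_minus: "open U \<Longrightarrow> smooth_on f U \<Longrightarrow> smooth_on (\<lambda>x. - f x) U"
  using smooth_on_bounded_linear[OF _ bounded_linear_minus[OF bounded_linear_ident]] .

lemma smooth_on_diff:
  "open U \<Longrightarrow> smooth_on f U \<Longrightarrow> smooth_on g U \<Longrightarrow> smooth_on (\<lambda>x. f x - g x) U"
  using smooth_on_add[OF _ _ smooth_on_minus] by fastforce

lemma bounded_bilinear_cross3: "bounded_bilinear cross3"
  using bilinear_cross bilinear_conv_bounded_bilinear by blast

lemmas smooth_on_mult = smooth_on_bounded_bilinear[OF _ bounded_bilinear_mult]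
  and smooth_on_scaleR = smooth_on_bounded_bilinear[OF _ bounded_bilinear_scaleR]
  and smooth_on_inner = smooth_on_bounded_bilinear[OF _ bounded_bilinear_inner]
  and smooth_on_cross3 = smooth_on_bounded_bilinear[OF _ bounded_bilinear_cross3]

lemma smooth_on_power:
  fixes f :: "'a::real_normed_vector \<Rightarrow> real"
  shows "open U \<Longrightarrow> smooth_on f U \<Longrightarrow> smooth_on (\<lambda>x. f x ^ n) U"
  by (induction n) (simp_all add: smooth_on_const smooth_on_mult)

lemma smooth_on_component: "open U \<Longrightarrow> smooth_on (\<lambda>x::real^'n. x $ i) U"
  using smooth_on_linear[OF _ bounded_linear_vec_nth] .

lemmas smooth_on_intros = smooth_on_const smooth_on_ident smooth_on_component smooth_on_add smooth_on_minus
  smooth_on_diff smooth_on_mult smooth_on_scaleR smooth_on_inner smooth_on_cross3 smooth_on_power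
  smooth_on_dir_deriv smooth_on_pd

section \<open>Second derivatives and Taylor remainders\<close>

lemma smooth_on_isCont: "smooth_on f U \<Longrightarrow> open U \<Longrightarrow> x \<in> U \<Longrightarrow> isCont f x"
  using smooth_on_imp_continuous_on continuous_on_eq_continuous_at by blast

lemma DERIV_along_line:
  fixes f :: "'a::real_normed_vector \<Rightarrow> real"
  assumes "f differentiable (at (b + s *\<^sub>R v))"
  shows "((\<lambda>s. f (b + s *\<^sub>R v)) has_real_derivative dir_deriv v f (b + s *\<^sub>R v)) (at s)"
proof -
  have "((\<lambda>s. f (b + s *\<^sub>R v)) has_derivative (\<lambda>r. dir_deriv (r *\<^sub>R v) f (b + s *\<^sub>R v))) (at s)"
    by (rule has_derivative_compose[where f = "\<lambda>s. b + s *\<^sub>R v" and g = f,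
          OF _ has_derivative_dir_deriv[OF assms]]) (auto intro!: derivative_eq_intros)
  then show ?thesis
    by (simp add: has_field_derivative_def linear_cmul[OF linear_dir_deriv[OF assms]] mult.commute[of _ "dir_deriv v f _"])
qed

text \<open>The second difference on the left is symmetric in \<open>v\<close>, \<open>w\<close> and involves no derivative: this
  yields both the symmetry of second derivatives and their vanishing for remainders of order
  above 2.\<close>

lemma second_difference_mean_value:
  fixes f :: "'a::real_normed_vector \<Rightarrow> real"
  assumes "open U" "a \<in> U" "smooth_on f U" "\<delta> > 0"
  shows "\<exists>t\<^sub>0>0. \<forall>t. 0 < t \<longrightarrow> t < t\<^sub>0 \<longrightarrow> (\<exists>x\<in>ball a \<delta>.
    f (a + t *\<^sub>R v + t *\<^sub>R w) - f (a + t *\<^sub>R v) - f (a + t *\<^sub>R w) + f a = t\<^sup>2 * dir_deriv w (dir_deriv v f) x)"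
proof -
  obtain e' where "e' > 0" "ball a e' \<subseteq> U"
    using assms(1,2) open_contains_ball by blast
  define e where "e = min e' \<delta>"
  have e: "e > 0" "ball a e \<subseteq> U" "ball a e \<subseteq> ball a \<delta>"
    using \<open>e' > 0\<close> \<open>ball a e' \<subseteq> U\<close> assms(4) by (auto simp: e_def)
  \<comment> \<open>The summand 1 keeps \<open>N\<close> positive when both directions
    vanish.\<close>
  define N where "N = norm v + norm w + 1"
  have N: "N > 0" by (simp add: N_def add_nonneg_pos)
  have "\<exists>x\<in>ball a \<delta>. f (a + t *\<^sub>R v + t *\<^sub>R w) - f (a + t *\<^sub>R v) - f (a + t *\<^sub>R w) + f a
      = t\<^sup>2 * dir_deriv w (dir_deriv v f) x" if t: "0 < t" "t < e / N" for t
  proof -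
    have inb: "a + s *\<^sub>R v + r *\<^sub>R w \<in> ball a e" if "0 \<le> s" "s \<le> t" "0 \<le> r" "r \<le> t" for s r
    proof -
      have "norm (s *\<^sub>R v + r *\<^sub>R w) \<le> s * norm v + r * norm w"
        using that by (metis norm_triangle_ineq norm_scaleR abs_of_nonneg)
      also have "\<dots> \<le> t * norm v + t * norm w"
        using that by (intro add_mono mult_right_mono) auto
      also have "\<dots> \<le> t * N" using t by (simp add: N_def algebra_simps)
      also have "\<dots> < e" using t N by (simp add: pos_less_divide_eq)
      finally have "norm (s *\<^sub>R v + r *\<^sub>R w) < e" .
      moreover have "dist a (a + s *\<^sub>R v + r *\<^sub>R w) = norm (s *\<^sub>R v + r *\<^sub>R w)"
        by (metis add.assoc add_diff_cancel_left' dist_commute dist_norm)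
      ultimately show ?thesis by simp
    qed
    have swap: "a + s *\<^sub>R v + r *\<^sub>R w = (a + r *\<^sub>R w) + s *\<^sub>R v" for s r
      by (simp add: algebra_simps)
    have df: "f differentiable (at (a + s *\<^sub>R v + r *\<^sub>R w))"
      "dir_deriv v f differentiable (at (a + s *\<^sub>R v + r *\<^sub>R w))"
      if "0 \<le> s" "s \<le> t" "0 \<le> r" "r \<le> t" for s r
      using inb[OF that] e(2) assms(3)
      by (auto intro!: smooth_on_imp_differentiable[of _ U] smooth_on_dir_deriv)
    \<comment> \<open>\<open>g\<close> is the first difference along \<open>w\<close>, as a function
      of the displacement along \<open>v\<close>; the second difference is \<open>g t - g 0\<close>.
      The mean value theorem in \<open>s\<close> and then in \<open>r\<close> yields the two factors
      \<open>t\<close>.\<close>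
    define g where "g s = f ((a + t *\<^sub>R w) + s *\<^sub>R v) - f (a + s *\<^sub>R v)" for s
    define g' where "g' s = dir_deriv v f ((a + t *\<^sub>R w) + s *\<^sub>R v) - dir_deriv v f (a + s *\<^sub>R v)" for s
    have "DERIV g s :> g' s" if "0 \<le> s" "s \<le> t" for s
      unfolding g_def g'_def
      using df(1)[of s t] df(1)[of s 0] that t
      by (intro DERIV_diff DERIV_along_line) (simp_all add: swap)
    then obtain s where s: "0 < s" "s < t" "g t - g 0 = t * g' s"
      using MVT2[of 0 t g g'] t by auto
    have "DERIV (\<lambda>r. dir_deriv v f ((a + s *\<^sub>R v) + r *\<^sub>R w)) r
        :> dir_deriv w (dir_deriv v f) ((a + s *\<^sub>R v) + r *\<^sub>R w)" if "0 \<le> r" "r \<le> t" for r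
      using df(2)[of s r] s that t by (intro DERIV_along_line) auto
    then obtain r where r: "0 < r" "r < t"
      "dir_deriv v f ((a + s *\<^sub>R v) + t *\<^sub>R w) - dir_deriv v f ((a + s *\<^sub>R v) + 0 *\<^sub>R w)
        = t * dir_deriv w (dir_deriv v f) ((a + s *\<^sub>R v) + r *\<^sub>R w)"
      using MVT2[of 0 t "\<lambda>r. dir_deriv v f ((a + s *\<^sub>R v) + r *\<^sub>R w)"
          "\<lambda>r. dir_deriv w (dir_deriv v f) ((a + s *\<^sub>R v) + r *\<^sub>R w)"] t by auto
    have "g t - g 0 = t * (t * dir_deriv w (dir_deriv v f) (a + s *\<^sub>R v + r *\<^sub>R w))"
      using s(3) r(3) by (simp add: g'_def swap)
    then have "f (a + t *\<^sub>R v + t *\<^sub>R w) - f (a + t *\<^sub>R v) - f (a + t *\<^sub>R w) + f a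
      = t\<^sup>2 * dir_deriv w (dir_deriv v f) (a + s *\<^sub>R v + r *\<^sub>R w)"
      by (simp add: g_def swap power2_eq_square algebra_simps)
    then show ?thesis
      using inb[of s r] s r e(3) by (intro bexI[of _ "a + s *\<^sub>R v + r *\<^sub>R w"]) auto
  qed
  then show ?thesis using e(1) N by (intro exI[of _ "e / N"]) auto
qed

text \<open>If the two values differed, take \<open>\<eta>\<close> to be half their distance. For
  small \<open>t\<close> the same second difference, divided by \<open>t\<^sup>2\<close>, is a value
  of each mixed derivative near \<open>a\<close>, within \<open>\<eta>\<close> of its value at
  \<open>a\<close>, which is impossible.\<close>

lemma dir_deriv_commute_real:
  fixes f :: "'a::real_normed_vector \<Rightarrow> real"
  assumes "open U" "a \<in> U" "smooth_on f U"
  shows "dir_deriv w (dir_deriv v f) a = dir_deriv v (dir_deriv w f) a"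
proof (rule ccontr)
  let ?F = "dir_deriv w (dir_deriv v f)" and ?G = "dir_deriv v (dir_deriv w f)"
  assume ne: "?F a \<noteq> ?G a"
  define \<eta> where "\<eta> = \<bar>?F a - ?G a\<bar> / 2"
  have \<eta>: "\<eta> > 0" using ne by (simp add: \<eta>_def)
  have "isCont ?F a" "isCont ?G a"
    using smooth_on_isCont[OF _ assms(1,2)] smooth_on_dir_deriv[OF smooth_on_dir_deriv[OF assms(3)]]
    by blast+
  then obtain d1 d2 where d: "d1 > 0" "d2 > 0"
    "\<And>x. dist x a < d1 \<Longrightarrow> dist (?F x) (?F a) < \<eta>"
    "\<And>x. dist x a < d2 \<Longrightarrow> dist (?G x) (?G a) < \<eta>"
    using \<eta> unfolding continuous_at_eps_delta by (metis (no_types, lifting))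
  obtain t1 t2 where t12: "t1 > 0" "t2 > 0"
    and t1: "\<And>t. 0 < t \<Longrightarrow> t < t1 \<Longrightarrow> \<exists>x\<in>ball a d1.
      f (a + t *\<^sub>R v + t *\<^sub>R w) - f (a + t *\<^sub>R v) - f (a + t *\<^sub>R w) + f a = t\<^sup>2 * ?F x"
    and t2: "\<And>t. 0 < t \<Longrightarrow> t < t2 \<Longrightarrow> \<exists>x\<in>ball a d2.
      f (a + t *\<^sub>R w + t *\<^sub>R v) - f (a + t *\<^sub>R w) - f (a + t *\<^sub>R v) + f a = t\<^sup>2 * ?G x"
    using second_difference_mean_value[OF assms d(1), of v w]
      second_difference_mean_value[OF assms d(2), of w v] by metis
  define t where "t = min t1 t2 / 2"
  have t: "0 < t" "t < t1" "t < t2" using t12 by (auto simp: t_def)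
  obtain x y where x: "x \<in> ball a d1" "f (a + t *\<^sub>R v + t *\<^sub>R w) - f (a + t *\<^sub>R v) - f (a + t *\<^sub>R w) + f a = t\<^sup>2 * ?F x"
    and y: "y \<in> ball a d2" "f (a + t *\<^sub>R w + t *\<^sub>R v) - f (a + t *\<^sub>R w) - f (a + t *\<^sub>R v) + f a = t\<^sup>2 * ?G y"
    using t1 t2 t by meson
  have "t\<^sup>2 * ?F x = t\<^sup>2 * ?G y"
    unfolding x(2)[symmetric] y(2)[symmetric] by (simp add: algebra_simps)
  then have "?F x = ?G y" using t by simp
  moreover have "\<bar>?F x - ?F a\<bar> < \<eta>" "\<bar>?G y - ?G a\<bar> < \<eta>"
    using d(3)[of x] d(4)[of y] x y by (auto simp: dist_commute dist_real_def)
  ultimately show False by (simp add: \<eta>_def abs_if split: if_splits)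
qed

lemma dir_deriv_bounded_linear:
  assumes "bounded_linear L" "f differentiable (at x)"
  shows "dir_deriv w (\<lambda>x. L (f x)) x = L (dir_deriv w f x)"
  using bounded_linear.has_derivative[OF assms(1) has_derivative_dir_deriv[OF assms(2)]]
  by (rule dir_deriv_eq)

text \<open>Pairing with basis vectors reduces to the real case. The vector version is what the
  conormal requires.\<close>

lemma dir_deriv_commute:
  fixes f :: "'a::real_normed_vector \<Rightarrow> 'b::euclidean_space"
  assumes "open U" "a \<in> U" "smooth_on f U"
  shows "dir_deriv w (dir_deriv v f) a = dir_deriv v (dir_deriv w f) a"
proof (rule euclidean_eqI)
  fix i :: 'b
  have L: "bounded_linear (\<lambda>y::'b. y \<bullet> i)" by (rule bounded_linear_inner_left)
  have *: "dir_deriv w (dir_deriv v f) a \<bullet> i = dir_deriv w (dir_deriv v (\<lambda>x. f x \<bullet> i)) a" for v w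
  proof -
    have s: "smooth_on (dir_deriv v f) U" "smooth_on (\<lambda>x. dir_deriv v f x \<bullet> i) U"
      using smooth_on_dir_deriv[OF assms(3)]
        smooth_on_bounded_linear[OF assms(1) L smooth_on_dir_deriv[OF assms(3)]] by blast+
    have "dir_deriv w (dir_deriv v f) a \<bullet> i = dir_deriv w (\<lambda>x. dir_deriv v f x \<bullet> i) a"
      using dir_deriv_bounded_linear[OF L smooth_on_imp_differentiable[OF s(1) assms(2)]] by simp
    also have "\<dots> = dir_deriv w (dir_deriv v (\<lambda>x. f x \<bullet> i)) a"
      using smooth_on_imp_differentiable[OF s(2) assms(2)] assms(1,2)
      by (rule dir_deriv_cong)
        (use dir_deriv_bounded_linear[OF L smooth_on_imp_differentiable[OF assms(3)]] in simp)
    finally show ?thesis .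
  qed
  show "dir_deriv w (dir_deriv v f) a \<bullet> i = dir_deriv v (dir_deriv w f) a \<bullet> i"
    unfolding *
    by (rule dir_deriv_commute_real[OF assms(1,2) smooth_on_bounded_linear[OF assms(1) L assms(3)]])
qed

text \<open>The second difference consists of four values of size \<open>O(t^k)\<close> with
  \<open>k \<ge> 3\<close>. Divided by \<open>t\<^sup>2\<close> it tends to 0, while by the mean
  value form it tends to the second derivative.\<close>

lemma terms_of_order_imp_second_deriv_zero:
  assumes "open U" "0 \<in> U" "terms_of_order k U R" "k > 2"
  shows "dir_deriv w (dir_deriv v R) 0 = 0"
proof (rule ccontr)
  let ?F = "dir_deriv w (dir_deriv v R)"
  assume ne: "?F 0 \<noteq> 0"
  have R: "smooth_on R U" "R \<in> O[nhds 0](\<lambda>x. norm x ^ k)"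
    using assms(3) by (auto simp: terms_of_order_def)
  obtain C where C: "C > 0" "eventually (\<lambda>x. norm (R x) \<le> C * norm (norm x ^ k)) (nhds 0)"
    using R(2) by (auto elim: landau_o.bigE)
  obtain \<rho> where \<rho>: "\<rho> > 0" "\<And>x. norm x < \<rho> \<Longrightarrow> \<bar>R x\<bar> \<le> C * norm x ^ k"
    using C(2) by (auto simp: eventually_nhds_metric dist_norm)
  have "isCont ?F 0"
    using smooth_on_isCont[OF _ assms(1,2)] smooth_on_dir_deriv[OF smooth_on_dir_deriv[OF R(1)]]
    by blast
  then obtain \<delta> where \<delta>: "\<delta> > 0" "\<And>x. dist x 0 < \<delta> \<Longrightarrow> dist (?F x) (?F 0) < \<bar>?F 0\<bar> / 2"
    using ne unfolding continuous_at_eps_delta by (meson half_gt_zero zero_less_abs_iff)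
  obtain t0 where t0: "t0 > 0"
    "\<And>t. 0 < t \<Longrightarrow> t < t0 \<Longrightarrow> \<exists>x\<in>ball 0 \<delta>.
      R (0 + t *\<^sub>R v + t *\<^sub>R w) - R (0 + t *\<^sub>R v) - R (0 + t *\<^sub>R w) + R 0 = t\<^sup>2 * ?F x"
    using second_difference_mean_value[OF assms(1,2) R(1) \<delta>(1), of v w] by metis
  define N where "N = norm v + norm w + 1"
  have N: "N \<ge> 1" by (simp add: N_def)
  \<comment> \<open>8 is 4 values times 2, since the estimate is compared with half of
    \<open>\<bar>?F 0\<bar>\<close>; the summand 1 makes that comparison strict.\<close>
  define B where "B = 8 * C * N ^ k + 1"
  have B: "B > 0" using C N by (simp add: B_def add_nonneg_pos)
  \<comment> \<open>The entries of the minimum serve, in order: the second difference formula, the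
    growth bound at points of norm at most \<open>t * N\<close>, the passage from
    \<open>t ^ k\<close> to \<open>t ^ 3\<close>, and the final contradiction.\<close>
  define t where "t = min (min (t0 / 2) (\<rho> / (2 * N))) (min 1 (\<bar>?F 0\<bar> / B))"
  have t: "0 < t" "t < t0" "t \<le> 1" "t \<le> \<bar>?F 0\<bar> / B" "t \<le> \<rho> / (2 * N)"
    using t0(1) \<rho>(1) N B ne by (auto simp: t_def)
  have "t * (2 * N) \<le> \<rho>" using t(5) N by (simp add: pos_le_divide_eq)
  then have tN: "t * N < \<rho>" using t(1) N \<rho>(1) by (simp add: mult.left_commute)
  have bd: "\<bar>R x\<bar> \<le> C * N ^ k * t ^ 3" if "norm x \<le> t * N" for x
  proof -
    have "\<bar>R x\<bar> \<le> C * norm x ^ k" using \<rho>(2) that tN by simp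
    also have "\<dots> \<le> C * (t * N) ^ k" using C that by (intro mult_left_mono power_mono) auto
    also have "\<dots> = C * N ^ k * t ^ k" by (simp add: power_mult_distrib)
    also have "\<dots> \<le> C * N ^ k * t ^ 3"
      using C N t assms(4) by (intro mult_left_mono power_decreasing) auto
    finally show ?thesis .
  qed
  have le: "norm (t *\<^sub>R v) \<le> t * N" "norm (t *\<^sub>R w) \<le> t * N" "norm (t *\<^sub>R v + t *\<^sub>R w) \<le> t * N"
    "norm (0 :: real^2) \<le> t * N"
    using t(1) N norm_triangle_ineq[of v w]
    by (auto simp: N_def scaleR_add_right[symmetric] simp del: scaleR_add_right)
  obtain x where x: "x \<in> ball 0 \<delta>"
    "R (t *\<^sub>R v + t *\<^sub>R w) - R (t *\<^sub>R v) - R (t *\<^sub>R w) + R 0 = t\<^sup>2 * ?F x"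
    using t0(2)[OF t(1,2)] by auto
  have "\<bar>t\<^sup>2 * ?F x\<bar> \<le> 4 * (C * N ^ k * t ^ 3)"
    using bd[OF le(1)] bd[OF le(2)] bd[OF le(3)] bd[OF le(4)] x(2) by linarith
  then have "t\<^sup>2 * \<bar>?F x\<bar> \<le> t\<^sup>2 * (4 * C * N ^ k * t)"
    by (simp add: abs_mult power2_eq_square power3_eq_cube mult_ac)
  then have "\<bar>?F x\<bar> \<le> 4 * C * N ^ k * t" using t(1) by simp
  moreover have "2 * (4 * C * N ^ k * t) < B * t" using t(1) by (simp add: B_def algebra_simps)
  moreover have "B * t \<le> \<bar>?F 0\<bar>" using t(4) B by (simp add: pos_le_divide_eq mult.commute)
  moreover have "\<bar>?F x - ?F 0\<bar> < \<bar>?F 0\<bar> / 2" using \<delta>(2)[of x] x(1) by (simp add: dist_real_def)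
  ultimately show False by linarith
qed

section \<open>First-order Taylor estimate at the origin\<close>

lemma differentiable_bound_at_zero:
  fixes g :: "'a::real_normed_vector \<Rightarrow> real"
  assumes "g differentiable (at 0)" "g 0 = 0"
  shows "\<exists>C>0. \<exists>d>0. \<forall>x. norm x < d \<longrightarrow> \<bar>g x\<bar> \<le> C * norm x"
proof -
  obtain g' where g': "(g has_derivative g') (at 0)" using assms(1) by (auto simp: differentiable_def)
  then obtain K where K: "K > 0" "\<And>x. norm (g' x) \<le> norm x * K"
    using bounded_linear.pos_bounded has_derivative_bounded_linear by blast
  obtain d where d: "d > 0" "\<And>x. norm x < d \<Longrightarrow> \<bar>g x - g' x\<bar> \<le> norm x"
    using g' assms(2) unfolding has_derivative_at_alt
    by (metis diff_zero mult_1 real_norm_def zero_less_one)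
  have "\<bar>g x\<bar> \<le> (K + 1) * norm x" if "norm x < d" for x
    using d(2)[OF that] K(2)[of x] by (simp add: algebra_simps)
  with d(1) K(1) show ?thesis by (intro exI[of _ "K + 1"]) auto
qed

lemma dir_deriv_real2:
  fixes f :: "real^2 \<Rightarrow> 'b::real_normed_vector"
  assumes "f differentiable (at x)"
  shows "dir_deriv w f x = (w $ 1) *\<^sub>R pd_u f x + (w $ 2) *\<^sub>R pd_v f x"
proof -
  have "w = (w $ 1) *\<^sub>R axis 1 1 + (w $ 2) *\<^sub>R axis 2 1"
    by (simp add: vec_eq_iff forall_2 axis_def)
  then show ?thesis
    using linear_add[OF linear_dir_deriv[OF assms]] linear_cmul[OF linear_dir_deriv[OF assms]]
    by (metis pd_u_eq_dir_deriv pd_v_eq_dir_deriv)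
qed

text \<open>By the mean value theorem on the segment from 0 to \<open>x\<close>, the value
  \<open>f x\<close> is the derivative along \<open>x\<close> at an intermediate point. One factor
  \<open>norm x\<close> comes from the direction, the other from the partial derivatives, which
  vanish at 0 and are differentiable there.\<close>

lemma terms_of_order_2I:
  assumes "open V" "0 \<in> V" "smooth_on f V" "f 0 = 0" "pd_u f 0 = 0" "pd_v f 0 = 0"
  shows "terms_of_order 2 V f"
proof -
  obtain e where e: "e > 0" "ball 0 e \<subseteq> V" using assms(1,2) open_contains_ball by blast
  have "pd_u f differentiable (at 0)" "pd_v f differentiable (at 0)"
    using assms(2,3) smooth_on_imp_differentiable smooth_on_pd by blast+
  then obtain C1 C2 d1 d2 where C: "C1 > 0" "d1 > 0" "C2 > 0" "d2 > 0"
    "\<And>x. norm x < d1 \<Longrightarrow> \<bar>pd_u f x\<bar> \<le> C1 * norm x"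
    "\<And>x. norm x < d2 \<Longrightarrow> \<bar>pd_v f x\<bar> \<le> C2 * norm x"
    using differentiable_bound_at_zero[of "pd_u f"] differentiable_bound_at_zero[of "pd_v f"] assms(5,6)
    by metis
  have bound: "\<bar>f x\<bar> \<le> (C1 + C2) * (norm x)\<^sup>2" if x: "norm x < min e (min d1 d2)" for x
  proof -
    have le: "norm (t *\<^sub>R x) \<le> norm x" if "0 \<le> t" "t \<le> 1" for t
      using that by (simp add: mult_left_le_one_le)
    have df: "f differentiable (at (t *\<^sub>R x))" if "0 \<le> t" "t \<le> 1" for t
      using smooth_on_imp_differentiable[OF assms(3), of "t *\<^sub>R x"] le[OF that] x e(2)
      by (auto simp: subset_iff)
    have "DERIV (\<lambda>t. f (t *\<^sub>R x)) t :> dir_deriv x f (t *\<^sub>R x)" if "0 \<le> t" "t \<le> 1" for t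
      using DERIV_along_line[of f 0 t x] df[OF that] by simp
    then obtain t where t: "0 < t" "t < 1" "f x = dir_deriv x f (t *\<^sub>R x)"
      using MVT2[of 0 1 "\<lambda>t. f (t *\<^sub>R x)" "\<lambda>t. dir_deriv x f (t *\<^sub>R x)"] assms(4) by auto
    let ?y = "t *\<^sub>R x"
    have y: "norm ?y \<le> norm x" using le t by simp
    have "\<bar>f x\<bar> \<le> \<bar>x $ 1\<bar> * \<bar>pd_u f ?y\<bar> + \<bar>x $ 2\<bar> * \<bar>pd_v f ?y\<bar>"
      unfolding t(3) dir_deriv_real2[OF df[OF less_imp_le[OF t(1)] less_imp_le[OF t(2)]]]
      by (metis abs_mult abs_triangle_ineq real_scaleR_def)
    also have "\<dots> \<le> norm x * (C1 * norm x) + norm x * (C2 * norm x)"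
    proof (intro add_mono mult_mono component_le_norm_cart)
      have "\<bar>pd_u f ?y\<bar> \<le> C1 * norm ?y" using C(5)[of ?y] y x by simp
      also have "\<dots> \<le> C1 * norm x" using y C(1) by (intro mult_left_mono) auto
      finally show "\<bar>pd_u f ?y\<bar> \<le> C1 * norm x" .
      have "\<bar>pd_v f ?y\<bar> \<le> C2 * norm ?y" using C(6)[of ?y] y x by simp
      also have "\<dots> \<le> C2 * norm x" using y C(3) by (intro mult_left_mono) auto
      finally show "\<bar>pd_v f ?y\<bar> \<le> C2 * norm x" .
    qed auto
    finally show ?thesis by (simp add: power2_eq_square algebra_simps)
  qed
  have "f \<in> O[nhds 0](\<lambda>x. norm x ^ 2)"
    by (rule landau_o.bigI[of "C1 + C2"])
      (use C e(1) bound in \<open>auto simp: eventually_nhds_metric dist_norm intro!: exI[of _ "min e (min d1 d2)"]\<close>)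
  with assms(3) show ?thesis by (simp add: terms_of_order_def)
qed

section \<open>Binary cubic forms\<close>

text \<open>After division by \<open>a\<close>, the number \<open>M\<close> is a Cauchy-type bound:
  at \<open>M\<close> and \<open>-M\<close> the cube dominates the lower terms, so the sign changes
  between them.\<close>

lemma cubic_has_real_root:
  fixes a b c d :: real
  assumes "a \<noteq> 0"
  shows "\<exists>t. a * t^3 + b * t\<^sup>2 + c * t + d = 0"
proof -
  define B C D where "B = b / a" "C = c / a" "D = d / a"
  define g where "g t = t^3 + B * t\<^sup>2 + C * t + D" for t
  define M where "M = 1 + \<bar>B\<bar> + \<bar>C\<bar> + \<bar>D\<bar>"
  have M: "M \<ge> 1" by (simp add: M_def)
  then have M1: "M \<le> M\<^sup>2" "1 \<le> M\<^sup>2" by (simp_all add: self_le_power)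
  have est: "\<bar>B * t\<^sup>2 + C * t + D\<bar> < M ^ 3" if t: "\<bar>t\<bar> = M" for t
  proof -
    have t2: "t\<^sup>2 = M\<^sup>2" using t by (metis power2_abs)
    have "\<bar>B * t\<^sup>2 + C * t + D\<bar> \<le> \<bar>B * t\<^sup>2\<bar> + \<bar>C * t\<bar> + \<bar>D\<bar>" by linarith
    also have "\<dots> = \<bar>B\<bar> * M\<^sup>2 + \<bar>C\<bar> * M + \<bar>D\<bar>" using t by (simp add: abs_mult t2)
    also have "\<dots> \<le> \<bar>B\<bar> * M\<^sup>2 + \<bar>C\<bar> * M\<^sup>2 + \<bar>D\<bar> * M\<^sup>2"
      using M1 mult_left_mono[OF M1(1), of "\<bar>C\<bar>"] mult_left_mono[OF M1(2), of "\<bar>D\<bar>"] by simp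
    also have "\<dots> < M * M\<^sup>2" using M by (simp add: M_def algebra_simps add_pos_nonneg)
    also have "\<dots> = M ^ 3" by (simp add: power2_eq_square power3_eq_cube)
    finally show ?thesis .
  qed
  have "g (- M) \<le> 0" "0 \<le> g M"
    using est[of "- M"] est[of M] M by (auto simp: g_def)
  moreover have "\<forall>x. isCont g x" unfolding g_def by (intro allI continuous_intros)
  ultimately obtain t where "g t = 0" using IVT[of g "- M" 0 M] M by auto
  moreover have "a * g t = a * t^3 + b * t\<^sup>2 + c * t + d"
    using assms by (simp add: g_def B_C_D_def distrib_left)
  ultimately show ?thesis by (intro exI[of _ t]) simp
qed

text \<open>The polarisation of the cubic \<open>a u^3 + 3 b u^2 v + 3 c u v^2 + d v^3\<close>,
  which is recovered on the diagonal.\<close>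

definition cubic_polar :: "real \<Rightarrow> real \<Rightarrow> real \<Rightarrow> real \<Rightarrow> real^2 \<Rightarrow> real^2 \<Rightarrow> real^2 \<Rightarrow> real" where
  "cubic_polar a b c d x y z =
     a * (x$1 * y$1 * z$1) + b * (x$1 * y$1 * z$2 + x$1 * y$2 * z$1 + x$2 * y$1 * z$1)
     + c * (x$1 * y$2 * z$2 + x$2 * y$1 * z$2 + x$2 * y$2 * z$1) + d * (x$2 * y$2 * z$2)"

text \<open>The hypothesis says that the discriminant is nonzero. The four conclusions are the
  coefficients, up to binomial factors, of \<open>v^3 - 3 \<epsilon> u^2 v\<close> in the basis
  \<open>p\<close>, \<open>q\<close>.\<close>

lemma cubic_normal_form:
  fixes a b c d :: real
  assumes disc: "4 * (a * c - b\<^sup>2) * (b * d - c\<^sup>2) \<noteq> (a * d - b * c)\<^sup>2"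
  obtains \<epsilon> p q where "\<epsilon> \<in> {1, -1}" "p$1 * q$2 \<noteq> p$2 * q$1"
    "cubic_polar a b c d p p p = 0" "cubic_polar a b c d p p q = - \<epsilon>"
    "cubic_polar a b c d p q q = 0" "cubic_polar a b c d q q q = 1"
proof -
  let ?T = "cubic_polar a b c d"
  \<comment> \<open>Put a real root of the cubic in first position; for \<open>a = 0\<close> the discriminant becomes
    \<open>b\<^sup>2 (4bd - 3c\<^sup>2)\<close>.\<close>
  have "\<exists>e f. e$1 * f$2 \<noteq> e$2 * f$1 \<and> ?T e e e = 0
      \<and> ?T e e f * (4 * ?T e e f * ?T f f f - 3 * (?T e f f)\<^sup>2) \<noteq> 0"
  proof (cases "a = 0")
    case True
    let ?e = "vector [1, 0] :: real^2" and ?f = "vector [0, 1] :: real^2"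
    have "?T ?e ?e ?e = 0" "?T ?e ?e ?f = b" "?T ?e ?f ?f = c" "?T ?f ?f ?f = d"
      using True by (simp_all add: cubic_polar_def)
    moreover have "b\<^sup>2 * (4 * b * d - 3 * c\<^sup>2) = (a * d - b * c)\<^sup>2 - 4 * (a * c - b\<^sup>2) * (b * d - c\<^sup>2)"
      unfolding True by algebra
    then have "b * (4 * b * d - 3 * c\<^sup>2) \<noteq> 0" using disc by auto
    ultimately show ?thesis by (intro exI[of _ ?e] exI[of _ ?f]) auto
  next
    case False
    then obtain t where t: "a * t^3 + 3 * b * t\<^sup>2 + 3 * c * t + d = 0"
      using cubic_has_real_root by blast
    let ?e = "vector [t, 1] :: real^2" and ?f = "vector [1, 0] :: real^2"
    define b' c' where "b' = a * t\<^sup>2 + 2 * b * t + c" and "c' = a * t + b"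
    have T: "?T ?e ?e ?e = 0" "?T ?e ?e ?f = b'" "?T ?e ?f ?f = c'" "?T ?f ?f ?f = a"
      using t by (simp_all add: cubic_polar_def b'_def c'_def power2_eq_square power3_eq_cube algebra_simps)
    have d: "d = - (a * t^3 + 3 * b * t\<^sup>2 + 3 * c * t)" using t by linarith
    \<comment> \<open>The discriminant is unchanged because the basis \<open>e\<close>,
      \<open>f\<close> has determinant -1 and the determinant enters with an even power.\<close>
    have "b'\<^sup>2 * (4 * b' * a - 3 * c'\<^sup>2) = (a * d - b * c)\<^sup>2 - 4 * (a * c - b\<^sup>2) * (b * d - c\<^sup>2)"
      unfolding b'_def c'_def d by algebra
    then have "b' * (4 * b' * a - 3 * c'\<^sup>2) \<noteq> 0" using disc by auto
    with T show ?thesis by (intro exI[of _ ?e] exI[of _ ?f]) auto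
  qed
  then obtain e f where ef: "e$1 * f$2 \<noteq> e$2 * f$1" "?T e e e = 0"
    "?T e e f * (4 * ?T e e f * ?T f f f - 3 * (?T e f f)\<^sup>2) \<noteq> 0" by blast
  define \<beta> \<gamma> \<delta> where "\<beta> = ?T e e f" and "\<gamma> = ?T e f f" and "\<delta> = ?T f f f"
  have \<beta>: "\<beta> \<noteq> 0" "4 * \<beta> * \<delta> - 3 * \<gamma>\<^sup>2 \<noteq> 0" using ef(3) by (auto simp: \<beta>_def \<gamma>_def \<delta>_def)
  \<comment> \<open>The cubic is now \<open>v (3\<beta>u\<^sup>2 + 3\<gamma>uv + \<delta>v\<^sup>2)\<close>: complete the square, then rescale \<open>u\<close> and \<open>v\<close>.\<close>
  define k where "k = \<gamma> / (2 * \<beta>)"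
  define \<delta>' where "\<delta>' = \<delta> - 3 * \<gamma>\<^sup>2 / (4 * \<beta>)"
  \<comment> \<open>As \<open>?T e e e = 0\<close>, this shift leaves \<open>?T e e f\<close>
    unchanged and subtracts \<open>2 * k * \<beta>\<close> from \<open>?T e f f\<close>, which
    cancels \<open>\<gamma>\<close>.\<close>
  define g where "g = f - k *\<^sub>R e"
  have sc: "?T (r *\<^sub>R x) (s *\<^sub>R y) (t *\<^sub>R z) = r * s * t * ?T x y z" for r s t x y z
    by (simp add: cubic_polar_def algebra_simps)
  have "?T e e g = ?T e e f - k * ?T e e e"
    by (simp add: cubic_polar_def g_def algebra_simps)
  then have eeg: "?T e e g = \<beta>" by (simp add: ef \<beta>_def)
  have "?T e g g = ?T e f f - 2 * k * ?T e e f + k\<^sup>2 * ?T e e e"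
    by (simp add: cubic_polar_def g_def algebra_simps power2_eq_square)
  then have egg: "?T e g g = 0" using \<beta> by (simp add: ef \<beta>_def \<gamma>_def k_def)
  have "?T g g g = ?T f f f - 3 * k * ?T e f f + 3 * k\<^sup>2 * ?T e e f - k^3 * ?T e e e"
    by (simp add: cubic_polar_def g_def algebra_simps power2_eq_square power3_eq_cube)
  then have "?T g g g = \<delta> - 3 * k * \<gamma> + 3 * k\<^sup>2 * \<beta>"
    by (simp add: ef \<beta>_def \<gamma>_def \<delta>_def)
  then have ggg: "?T g g g = \<delta>'"
    using \<beta> by (simp add: \<delta>'_def k_def field_simps power2_eq_square)
  have \<delta>': "\<delta>' \<noteq> 0" using \<beta> by (simp add: \<delta>'_def field_simps)
  \<comment> \<open>The odd root absorbs the sign of \<open>\<delta>'\<close>. The scale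
    \<open>s\<close> of \<open>e\<close> enters only through its square, so the sign of
    \<open>r * \<beta>\<close> survives and becomes \<open>- \<epsilon>\<close>.\<close>
  define r where "r = inverse (root 3 \<delta>')"
  have r: "r \<noteq> 0" "r^3 * \<delta>' = 1"
    using \<delta>' odd_real_root_pow[of 3 \<delta>'] by (auto simp: r_def power_inverse)
  define s where "s = inverse (sqrt \<bar>r * \<beta>\<bar>)"
  have s: "s \<noteq> 0" "s\<^sup>2 * \<bar>r * \<beta>\<bar> = 1"
    using r \<beta> by (auto simp: s_def power_inverse)
  show ?thesis
  proof (rule that[of "- sgn (r * \<beta>)" "s *\<^sub>R e" "r *\<^sub>R g"])
    show "- sgn (r * \<beta>) \<in> {1, - 1}" using r \<beta> by (simp add: sgn_real_def)
    have "s * r * (e$1 * f$2 - e$2 * f$1) \<noteq> 0" using ef(1) s r by simp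
    then show "(s *\<^sub>R e) $ 1 * (r *\<^sub>R g) $ 2 \<noteq> (s *\<^sub>R e) $ 2 * (r *\<^sub>R g) $ 1"
      by (simp add: g_def algebra_simps)
    show "?T (s *\<^sub>R e) (s *\<^sub>R e) (s *\<^sub>R e) = 0" "?T (s *\<^sub>R e) (r *\<^sub>R g) (r *\<^sub>R g) = 0"
      by (simp_all add: sc ef egg)
    have "s * s * r * \<beta> = sgn (r * \<beta>) * (s\<^sup>2 * \<bar>r * \<beta>\<bar>)"
      by (simp add: power2_eq_square mult.assoc mult.left_commute[of "sgn _"] sgn_mult_abs)
    then show "?T (s *\<^sub>R e) (s *\<^sub>R e) (r *\<^sub>R g) = - (- sgn (r * \<beta>))"
      using s by (simp add: sc eeg)
    show "?T (r *\<^sub>R g) (r *\<^sub>R g) (r *\<^sub>R g) = 1"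
      using r(2) by (simp add: sc ggg power3_eq_cube)
  qed
qed

section \<open>Binary differential equations\<close>

text \<open>The preimage as source makes the map onto \<open>W\<close>. \<open>inv_into\<close> is
  known to equal the linear inverse only on \<open>W\<close>, so smoothness is transferred by
  congruence there.\<close>

lemma coordinate_change_linear:
  assumes "linear P" "inj P" "open W"
  shows "coordinate_change (P -` W) W P"
proof -
  obtain Q where Q: "linear Q" "\<And>x. Q (P x) = x" "\<And>x. P (Q x) = x"
    using linear_injective_isomorphism[OF assms(1,2)] by blast
  have V: "open (P -` W)"
    using assms(1,3) by (intro open_vimage linear_continuous_on) (simp_all add: linear_conv_bounded_linear)
  have inv: "inv_into (P -` W) P y = Q y" if "y \<in> W" for y
    using that Q by (metis assms(2) inj_on_subset inv_into_f_f subset_UNIV vimageI2)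
  have "smooth_on (inv_into (P -` W) P) W"
    by (rule smooth_on_cong[OF assms(3) inv[symmetric] smooth_on_linear[OF assms(3)]])
      (use Q(1) in \<open>simp_all add: linear_conv_bounded_linear\<close>)
  moreover have "bij_betw P (P -` W) W"
    using Q by (intro bij_betw_byWitness[where f' = Q]) auto
  moreover have "smooth_on P (P -` W)"
    using smooth_on_linear[OF V] assms(1) by (simp add: linear_conv_bounded_linear)
  ultimately show ?thesis using V assms(3) by (simp add: coordinate_change_def)
qed

text \<open>Every second derivative of \<open>l\<close>, \<open>m\<close>, \<open>n\<close> is
  multiplied by a value that vanishes at \<open>a\<close>, so only their first derivatives
  remain.\<close>

lemma dir_deriv_second_at_common_zero:
  fixes l m n :: "'a::real_normed_vector \<Rightarrow> real"
  assumes W: "open W" "a \<in> W" and s: "smooth_on l W" "smooth_on m W" "smooth_on n W"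
    and z: "l a = 0" "m a = 0" "n a = 0"
  shows "dir_deriv w (dir_deriv v (\<lambda>x. l x * n x - (m x)\<^sup>2)) a
    = dir_deriv v l a * dir_deriv w n a + dir_deriv w l a * dir_deriv v n a - 2 * dir_deriv v m a * dir_deriv w m a"
proof -
  have hd: "(f has_derivative (\<lambda>w. dir_deriv w f x)) (at x)" if "smooth_on f W" "x \<in> W" for f :: "'a \<Rightarrow> real" and x
    using that smooth_on_imp_differentiable has_derivative_dir_deriv by blast
  let ?F = "\<lambda>x. l x * n x - (m x)\<^sup>2"
  let ?G = "\<lambda>x. l x * dir_deriv v n x + dir_deriv v l x * n x - 2 * (m x * dir_deriv v m x)"
  have F: "dir_deriv v ?F x = ?G x" if "x \<in> W" for x
  proof -
    have "(?F has_derivative (\<lambda>v. l x * dir_deriv v n x + dir_deriv v l x * n x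
        - (m x * dir_deriv v m x + dir_deriv v m x * m x))) (at x)"
      unfolding power2_eq_square using that s by (intro has_derivative_diff has_derivative_mult hd)
    from dir_deriv_eq[OF this, of v] show ?thesis by simp
  qed
  have sF: "smooth_on ?F W" using W s by (intro smooth_on_intros)
  have "dir_deriv w (dir_deriv v ?F) a = dir_deriv w ?G a"
    using smooth_on_imp_differentiable[OF smooth_on_dir_deriv[OF sF] W(2)] W F by (rule dir_deriv_cong)
  also have "(?G has_derivative (\<lambda>w. (l a * dir_deriv w (dir_deriv v n) a + dir_deriv w l a * dir_deriv v n a)
      + (dir_deriv v l a * dir_deriv w n a + dir_deriv w (dir_deriv v l) a * n a)
      - 2 * (m a * dir_deriv w (dir_deriv v m) a + dir_deriv w m a * dir_deriv v m a))) (at a)"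
    using W s
    by (intro has_derivative_diff has_derivative_add has_derivative_mult has_derivative_mult_right hd smooth_on_dir_deriv)
  from dir_deriv_eq[OF this, of w] have "dir_deriv w ?G a
    = dir_deriv v l a * dir_deriv w n a + dir_deriv w l a * dir_deriv v n a - 2 * dir_deriv v m a * dir_deriv w m a"
    using z by simp
  finally show ?thesis .
qed

text \<open>The two symmetry conditions say that the linear parts of \<open>l\<close>,
  \<open>m\<close>, \<open>n\<close> assemble to one symmetric trilinear form. The columns of the
  coordinate change are the basis vectors that normalise it.\<close>

lemma bde_normal_form:
  fixes l m n :: "real^2 \<Rightarrow> real"
  assumes W: "open W" "0 \<in> W" and s: "smooth_on l W" "smooth_on m W" "smooth_on n W"
    and z: "l 0 = 0" "m 0 = 0" "n 0 = 0"
    and sym: "pd_v l 0 = pd_u m 0" "pd_v m 0 = pd_u n 0"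
    and nd: "nondegenerate_critical_point (\<lambda>x. l x * n x - (m x)\<^sup>2) 0"
  shows "\<exists>\<epsilon> V \<phi> R\<^sub>1 R\<^sub>2 R\<^sub>3. \<epsilon> \<in> {1, -1} \<and> 0 \<in> V \<and> coordinate_change V W \<phi> \<and> \<phi> 0 = 0 \<and>
    terms_of_order 2 V R\<^sub>1 \<and> terms_of_order 2 V R\<^sub>2 \<and> terms_of_order 2 V R\<^sub>3 \<and>
    (\<forall>x\<in>V. \<forall>w. pullback_form \<phi> (bde_form l (\<lambda>x. 2 * m x) n) x w =
       bde_form (\<lambda>x. - \<epsilon> * x $ 2 + R\<^sub>1 x) (\<lambda>x. - 2 * \<epsilon> * x $ 1 + R\<^sub>2 x) (\<lambda>x. x $ 2 + R\<^sub>3 x) x w)"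
proof -
  define a b c d where "a = pd_u l 0" and "b = pd_u m 0" and "c = pd_u n 0" and "d = pd_v n 0"
  note abcd = a_def b_def c_def d_def
  \<comment> \<open>The second derivatives of \<open>l n - m\<^sup>2\<close> at 0 are
    \<open>2 (a c - b\<^sup>2)\<close>, \<open>a d - b c\<close> and
    \<open>2 (b d - c\<^sup>2)\<close>.\<close>
  have "4 * (a * c - b\<^sup>2) * (b * d - c\<^sup>2) \<noteq> (a * d - b * c)\<^sup>2"
    using nd sym
    unfolding nondegenerate_critical_point_def pd_u_eq_dir_deriv pd_v_eq_dir_deriv
      dir_deriv_second_at_common_zero[OF W s z] abcd
    by (simp add: power2_eq_square algebra_simps)
  then obtain \<epsilon> p q where \<epsilon>: "\<epsilon> \<in> {1, -1}" and pq: "p$1 * q$2 \<noteq> p$2 * q$1"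
    and T: "cubic_polar a b c d p p p = 0" "cubic_polar a b c d p p q = - \<epsilon>"
      "cubic_polar a b c d p q q = 0" "cubic_polar a b c d q q q = 1"
    using cubic_normal_form[of a c b d] by blast
  define P where "P x = (x $ 1) *\<^sub>R p + (x $ 2) *\<^sub>R q" for x :: "real^2"
  have P: "linear P" by (rule linearI) (simp_all add: P_def algebra_simps)
  have "x = 0" if "P x = 0" for x
  proof -
    have "x$1 * p$1 + x$2 * q$1 = 0" "x$1 * p$2 + x$2 * q$2 = 0"
      using that by (simp_all add: P_def vec_eq_iff forall_2)
    then have "(p$1 * q$2 - p$2 * q$1) * x$1 = 0" "(p$1 * q$2 - p$2 * q$1) * x$2 = 0"
      by algebra+
    with pq show "x = 0" by (simp add: vec_eq_iff forall_2)
  qed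
  then have inj: "inj P" using P by (simp add: linear_injective_0)
  define V where "V = P -` W"
  have cc: "coordinate_change V W P" unfolding V_def by (rule coordinate_change_linear[OF P inj W(1)])
  have P0: "P 0 = 0" using P by (rule linear_0)
  have V: "open V" "0 \<in> V" "P ` V \<subseteq> W"
    using cc W P0 by (auto simp: coordinate_change_def V_def)
  have bP: "bounded_linear P" using P by (simp add: linear_conv_bounded_linear)
  \<comment> \<open>The symmetric bilinear form with matrix entries \<open>l\<close>,
    \<open>m\<close>, \<open>n\<close>, scaled by \<open>k\<close>. Its values on pairs from
    \<open>p\<close>, \<open>q\<close>, at the point \<open>P x\<close>, are the pulled-back
    coefficients; \<open>k = 2\<close> serves the mixed one.\<close>
  define F where "F k v w x = k * (l x * (v$1 * w$1) + m x * (v$1 * w$2 + v$2 * w$1) + n x * (v$2 * w$2))"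
    for k and v w x :: "real^2"
  have rem: "terms_of_order 2 V (\<lambda>x. F k v w (P x) - (\<mu> * x$1 + \<nu> * x$2))"
    if \<mu>\<nu>: "\<mu> = k * cubic_polar a b c d p v w" "\<nu> = k * cubic_polar a b c d q v w" for k v w \<mu> \<nu>
  proof -
    have sF: "smooth_on (F k v w) W"
      unfolding F_def using W s by (intro smooth_on_intros)
    have dF: "dir_deriv y (F k v w) 0 = k * cubic_polar a b c d y v w" for y
    proof -
      have "(F k v w has_derivative (\<lambda>y. k * (dir_deriv y l 0 * (v$1 * w$1)
          + dir_deriv y m 0 * (v$1 * w$2 + v$2 * w$1) + dir_deriv y n 0 * (v$2 * w$2)))) (at 0)"
        unfolding F_def using s W(2)
        by (intro has_derivative_mult_right has_derivative_add has_derivative_mult_left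
            has_derivative_dir_deriv smooth_on_imp_differentiable)
      from dir_deriv_eq[OF this, of y] show ?thesis
        using smooth_on_imp_differentiable[OF s(1) W(2)] smooth_on_imp_differentiable[OF s(2) W(2)]
          smooth_on_imp_differentiable[OF s(3) W(2)] sym
        by (simp add: dir_deriv_real2 cubic_polar_def abcd algebra_simps)
    qed
    have "((\<lambda>x. F k v w (P x) - (\<mu> * x$1 + \<nu> * x$2)) has_derivative
        (\<lambda>y. dir_deriv (P y) (F k v w) (P 0) - (\<mu> * y$1 + \<nu> * y$2))) (at 0)"
      using smooth_on_imp_differentiable[OF sF W(2)] P0
      by (intro has_derivative_diff has_derivative_add has_derivative_mult_right
          has_derivative_compose[of P, OF bounded_linear_imp_has_derivative[OF bP]]
          has_derivative_dir_deriv bounded_linear_imp_has_derivative[OF bounded_linear_vec_nth]) simp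
    from dir_deriv_eq[OF this] have D: "dir_deriv y (\<lambda>x. F k v w (P x) - (\<mu> * x$1 + \<nu> * x$2)) 0
        = k * cubic_polar a b c d (P y) v w - (\<mu> * y$1 + \<nu> * y$2)" for y
      by (simp add: dF P0)
    show ?thesis
    proof (rule terms_of_order_2I[OF V(1,2)])
      show "smooth_on (\<lambda>x. F k v w (P x) - (\<mu> * x$1 + \<nu> * x$2)) V"
        using V bP sF by (intro smooth_on_intros smooth_on_compose_linear[of V P W])
      show "F k v w (P 0) - (\<mu> * 0$1 + \<nu> * 0$2) = 0" by (simp add: F_def P0 z)
      have "P (axis 1 1) = p" "P (axis 2 1) = q" by (simp_all add: P_def axis_def)
      then show "pd_u (\<lambda>x. F k v w (P x) - (\<mu> * x$1 + \<nu> * x$2)) 0 = 0"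
        "pd_v (\<lambda>x. F k v w (P x) - (\<mu> * x$1 + \<nu> * x$2)) 0 = 0"
        unfolding pd_u_eq_dir_deriv pd_v_eq_dir_deriv D by (simp_all add: \<mu>\<nu> axis_def)
    qed
  qed
  \<comment> \<open>The subtracted linear parts are \<open>T(x, p, p)\<close>,
    \<open>2 T(x, p, q)\<close> and \<open>T(x, q, q)\<close> for \<open>x\<close> running through
    \<open>p\<close> and \<open>q\<close>, read off from the normalised values.\<close>
  let ?R1 = "\<lambda>x. F 1 p p (P x) - (0 * x$1 + (- \<epsilon>) * x$2)"
  let ?R2 = "\<lambda>x. F 2 p q (P x) - ((- 2 * \<epsilon>) * x$1 + 0 * x$2)"
  let ?R3 = "\<lambda>x. F 1 q q (P x) - (0 * x$1 + 1 * x$2)"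
  have comm: "cubic_polar a b c d q p p = cubic_polar a b c d p p q"
    "cubic_polar a b c d q p q = cubic_polar a b c d p q q"
    by (simp_all add: cubic_polar_def algebra_simps)
  have R: "terms_of_order 2 V ?R1" "terms_of_order 2 V ?R2" "terms_of_order 2 V ?R3"
    by (rule rem; simp add: T comm)+
  have fd: "frechet_derivative P (at x) = P" for x
    using frechet_derivative_at[OF bounded_linear_imp_has_derivative[OF bP]] by simp
  have "pullback_form P (bde_form l (\<lambda>x. 2 * m x) n) x w =
      bde_form (\<lambda>x. - \<epsilon> * x $ 2 + ?R1 x) (\<lambda>x. - 2 * \<epsilon> * x $ 1 + ?R2 x) (\<lambda>x. x $ 2 + ?R3 x) x w" for x w
  proof -
    have Pw: "P w $ i = w$1 * p$i + w$2 * q$i" for i by (simp add: P_def)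
    show ?thesis
      unfolding pullback_form_def bde_form_def fd Pw F_def by algebra
  qed
  with \<epsilon> V(2) cc P0 R show ?thesis by blast
qed

section \<open>Affine geometry of graphs\<close>

text \<open>Rewriting the triple as a linear expression makes the sum and scalar rules
  applicable.\<close>

lemma vector_3_eq_sum: "(vector [a, b, c] :: real^3) = a *\<^sub>R axis 1 1 + b *\<^sub>R axis 2 1 + c *\<^sub>R axis 3 1"
  by (simp add: vec_eq_iff forall_3 axis_def)

lemma dir_deriv_vector_3:
  assumes "f differentiable (at x)" "g differentiable (at x)" "k differentiable (at x)"
  shows "dir_deriv w (\<lambda>x. vector [f x, g x, k x] :: real^3) x
    = vector [dir_deriv w f x, dir_deriv w g x, dir_deriv w k x]"
  unfolding vector_3_eq_sum
  by (rule dir_deriv_eq) (intro has_derivative_add has_derivative_scaleR_left has_derivative_dir_deriv assms)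

lemma smooth_on_vector_3:
  assumes "open U" "smooth_on f U" "smooth_on g U" "smooth_on k U"
  shows "smooth_on (\<lambda>x. vector [f x, g x, k x] :: real^3) U"
  unfolding vector_3_eq_sum using assms by (intro smooth_on_intros)

lemma dir_deriv_component: "dir_deriv w (\<lambda>x::real^'n. x $ i) x = w $ i"
  using dir_deriv_eq[OF bounded_linear_imp_has_derivative[OF bounded_linear_vec_nth]] .

lemma THE_dual_vector:
  assumes "n \<bullet> cross3 a b \<noteq> 0"
  shows "(THE \<xi>. n \<bullet> \<xi> = 1 \<and> \<xi> \<bullet> a = 0 \<and> \<xi> \<bullet> b = 0) = inverse (n \<bullet> cross3 a b) *\<^sub>R cross3 a b"
proof (rule the_equality)
  show "n \<bullet> (inverse (n \<bullet> cross3 a b) *\<^sub>R cross3 a b) = 1 \<and>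
    (inverse (n \<bullet> cross3 a b) *\<^sub>R cross3 a b) \<bullet> a = 0 \<and>
    (inverse (n \<bullet> cross3 a b) *\<^sub>R cross3 a b) \<bullet> b = 0"
    using assms by (simp add: dot_cross_self)
next
  fix \<xi> assume \<xi>: "n \<bullet> \<xi> = 1 \<and> \<xi> \<bullet> a = 0 \<and> \<xi> \<bullet> b = 0"
  \<comment> \<open>Expansion of \<open>\<xi>\<close> in the basis dual to \<open>n\<close>,
    \<open>a\<close>, \<open>b\<close>, with denominators cleared; this gives uniqueness.\<close>
  have "(n \<bullet> cross3 a b) *\<^sub>R \<xi> = (n \<bullet> \<xi>) *\<^sub>R cross3 a b + (\<xi> \<bullet> a) *\<^sub>R cross3 b n + (\<xi> \<bullet> b) *\<^sub>R cross3 n a"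
    by (simp add: cross3_simps forall_3)
  then have "(n \<bullet> cross3 a b) *\<^sub>R \<xi> = cross3 a b" using \<xi> by simp
  then show "\<xi> = inverse (n \<bullet> cross3 a b) *\<^sub>R cross3 a b"
    using assms by (metis left_inverse scaleR_one scaleR_scaleR)
qed

text \<open>This is LN - M^2 for the graph of \<open>h\<close>.\<close>

definition hessian_det :: "(real^2 \<Rightarrow> real) \<Rightarrow> real^2 \<Rightarrow> real" where
  "hessian_det h x = pd_u (pd_u h) x * pd_v (pd_v h) x - (pd_v (pd_u h) x)\<^sup>2"

lemma smooth_on_hessian_det: "open U \<Longrightarrow> smooth_on h U \<Longrightarrow> smooth_on (hessian_det h) U"
  unfolding hessian_det_def[abs_def] by (intro smooth_on_intros)

lemma smooth_on_graph_immersion: "open U \<Longrightarrow> smooth_on h U \<Longrightarrow> smooth_on (graph_immersion h) U"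
  unfolding graph_immersion_def[abs_def] by (intro smooth_on_vector_3 smooth_on_component)

lemma dir_deriv_graph_immersion:
  "h differentiable (at x) \<Longrightarrow> dir_deriv w (graph_immersion h) x = vector [w$1, w$2, dir_deriv w h x]"
  unfolding graph_immersion_def[abs_def]
  by (subst dir_deriv_vector_3)
    (simp_all add: dir_deriv_component bounded_linear_imp_differentiable bounded_linear_vec_nth)

text \<open>The horizontal entries of a first derivative are constant, so second derivatives are
  vertical and the determinants L, M, N reduce to second derivatives of \<open>h\<close>.\<close>

lemma dir_deriv2_graph_immersion:
  assumes "open U" "smooth_on h U" "x \<in> U"
  shows "dir_deriv v (dir_deriv w (graph_immersion h)) x = vector [0, 0, dir_deriv v (dir_deriv w h) x]"
proof -
  have "dir_deriv v (dir_deriv w (graph_immersion h)) x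
      = dir_deriv v (\<lambda>x. vector [w$1, w$2, dir_deriv w h x]) x"
    using assms
    by (intro dir_deriv_cong[of _ x U] dir_deriv_graph_immersion smooth_on_imp_differentiable[of _ U]
        smooth_on_dir_deriv smooth_on_graph_immersion)
  also have "\<dots> = vector [dir_deriv v (\<lambda>x. w$1) x, dir_deriv v (\<lambda>x. w$2) x, dir_deriv v (dir_deriv w h) x]"
    using assms
    by (intro dir_deriv_vector_3 smooth_on_imp_differentiable[of _ U] smooth_on_dir_deriv smooth_on_const)
  finally show ?thesis by (simp add: dir_deriv_def)
qed

lemma conormal_graph_immersion:
  assumes "open U" "smooth_on h U" "x \<in> U"
  shows "conormal (graph_immersion h) x
    = (\<bar>hessian_det h x\<bar> powr (-1/4)) *\<^sub>R vector [- pd_u h x, - pd_v h x, 1]"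
proof -
  note d = dir_deriv_graph_immersion[OF smooth_on_imp_differentiable[OF assms(2,3)]]
    dir_deriv2_graph_immersion[OF assms]
  have "cross3 (pd_u (graph_immersion h) x) (pd_v (graph_immersion h) x)
      = vector [- pd_u h x, - pd_v h x, 1]"
    by (simp add: pd_u_eq_dir_deriv pd_v_eq_dir_deriv d cross3_def axis_def)
  moreover have "coef_L (graph_immersion h) x * coef_N (graph_immersion h) x
      - (coef_M (graph_immersion h) x)\<^sup>2 = hessian_det h x"
    by (simp add: coef_L_def coef_M_def coef_N_def hessian_det_def pd_u_eq_dir_deriv pd_v_eq_dir_deriv
        d det_3 axis_def)
  ultimately show ?thesis by (simp add: conormal_def)
qed

lemma smooth_on_conormal_graph_immersion:
  assumes "open U" "smooth_on h U" and K: "\<And>x. x \<in> U \<Longrightarrow> hessian_det h x \<noteq> 0"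
  shows "smooth_on (conormal (graph_immersion h)) U"
proof (rule smooth_on_cong[OF assms(1) conormal_graph_immersion[OF assms(1,2), symmetric]])
  show "smooth_on (\<lambda>x. (\<bar>hessian_det h x\<bar> powr (-1/4)) *\<^sub>R vector [- pd_u h x, - pd_v h x, 1] :: real^3) U"
    using assms
    by (intro smooth_on_scaleR smooth_on_abs_powr smooth_on_hessian_det smooth_on_vector_3 smooth_on_intros)
qed

text \<open>Write \<open>\<nu> = \<rho> N\<close>. Derivatives of \<open>\<rho>\<close> contribute
  multiples of \<open>N\<close>, which drop out of the triple product, leaving
  \<open>\<rho> ^ 3\<close> times that of \<open>N\<close>. This is nonzero with the Hessian
  determinant, as the affine normal requires.\<close>

lemma conormal_graph_immersion_det:
  assumes U: "open U" "smooth_on h U" "x \<in> U" and K: "\<And>x. x \<in> U \<Longrightarrow> hessian_det h x \<noteq> 0"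
  defines "\<nu> \<equiv> conormal (graph_immersion h)"
  shows "\<nu> x \<bullet> cross3 (pd_u \<nu> x) (pd_v \<nu> x) = (\<bar>hessian_det h x\<bar> powr (-1/4)) ^ 3 * hessian_det h x"
proof -
  define \<rho> where "\<rho> x = \<bar>hessian_det h x\<bar> powr (-1/4)" for x
  define N :: "real^2 \<Rightarrow> real^3" where "N x = vector [- pd_u h x, - pd_v h x, 1]" for x
  have \<nu>: "\<nu> x = \<rho> x *\<^sub>R N x" if "x \<in> U" for x
    unfolding \<nu>_def \<rho>_def N_def using conormal_graph_immersion[OF U(1,2) that] .
  have s: "smooth_on \<rho> U" "smooth_on N U"
    unfolding \<rho>_def N_def using U K
    by (intro smooth_on_abs_powr smooth_on_hessian_det smooth_on_vector_3 smooth_on_intros; simp)+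
  have s\<nu>: "smooth_on \<nu> U"
    unfolding \<nu>_def by (rule smooth_on_conormal_graph_immersion[OF U(1,2) K])
  have df: "f differentiable (at x)" if "smooth_on f U" for f :: "real^2 \<Rightarrow> 'b::real_normed_vector"
    using smooth_on_imp_differentiable[OF that U(3)] .
  have hs: "smooth_on (\<lambda>x. - pd_u h x) U" "smooth_on (\<lambda>x. - pd_v h x) U"
    by (intro smooth_on_minus smooth_on_pd U)+
  have D: "dir_deriv w \<nu> x = \<rho> x *\<^sub>R vector [- dir_deriv w (pd_u h) x, - dir_deriv w (pd_v h) x, 0]
      + dir_deriv w \<rho> x *\<^sub>R N x" for w
  proof -
    have "dir_deriv w (\<lambda>x. \<rho> x *\<^sub>R N x) x = \<rho> x *\<^sub>R dir_deriv w N x + dir_deriv w \<rho> x *\<^sub>R N x"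
      using s by (intro dir_deriv_eq[OF has_derivative_scaleR] has_derivative_dir_deriv df)
    moreover have "dir_deriv w \<nu> x = dir_deriv w (\<lambda>x. \<rho> x *\<^sub>R N x) x"
      using df[OF s\<nu>] U(1,3) \<nu> by (rule dir_deriv_cong)
    moreover have "dir_deriv w N x = vector [dir_deriv w (\<lambda>x. - pd_u h x) x,
        dir_deriv w (\<lambda>x. - pd_v h x) x, dir_deriv w (\<lambda>x. 1) x]"
      unfolding N_def using hs by (intro dir_deriv_vector_3 df smooth_on_const)
    moreover have "dir_deriv w (\<lambda>x. - f x) x = - dir_deriv w f x" if "smooth_on f U" for f :: "real^2 \<Rightarrow> real"
      using df[OF that] by (intro dir_deriv_eq[OF has_derivative_minus] has_derivative_dir_deriv)
    ultimately show ?thesis using U by (simp add: dir_deriv_def[of _ "\<lambda>x. _"] smooth_on_pd)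
  qed
  have "pd_u (pd_v h) x = pd_v (pd_u h) x"
    unfolding pd_u_eq_dir_deriv pd_v_eq_dir_deriv by (rule dir_deriv_commute[OF U(1,3,2)])
  moreover have "pd_u \<nu> x = \<rho> x *\<^sub>R vector [- pd_u (pd_u h) x, - pd_u (pd_v h) x, 0] + pd_u \<rho> x *\<^sub>R N x"
    using D[of "axis 1 1"] by (simp add: pd_u_eq_dir_deriv)
  moreover have "pd_v \<nu> x = \<rho> x *\<^sub>R vector [- pd_v (pd_u h) x, - pd_v (pd_v h) x, 0] + pd_v \<rho> x *\<^sub>R N x"
    using D[of "axis 2 1"] by (simp add: pd_v_eq_dir_deriv)
  ultimately have "\<nu> x \<bullet> cross3 (pd_u \<nu> x) (pd_v \<nu> x) = \<rho> x ^ 3 * hessian_det h x"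
    by (simp add: \<nu>[OF U(3)] N_def hessian_det_def cross3_def inner_vec_def sum_3
        power2_eq_square power3_eq_cube algebra_simps)
  then show "\<nu> x \<bullet> cross3 (pd_u \<nu> x) (pd_v \<nu> x) = (\<bar>hessian_det h x\<bar> powr (-1/4)) ^ 3 * hessian_det h x"
    by (simp add: \<rho>_def)
qed

text \<open>The nonzero triple product turns the definite description into a quotient of smooth
  expressions, and a cross product is orthogonal to its factors.\<close>

lemma affine_normal_graph_immersion:
  assumes U: "open U" "smooth_on h U" and K: "\<And>x. x \<in> U \<Longrightarrow> hessian_det h x \<noteq> 0"
  defines "\<nu> \<equiv> conormal (graph_immersion h)" and "\<xi> \<equiv> affine_normal (graph_immersion h)"
  shows "smooth_on \<xi> U"
    and "x \<in> U \<Longrightarrow> pd_u \<nu> x \<bullet> \<xi> x = 0" and "x \<in> U \<Longrightarrow> pd_v \<nu> x \<bullet> \<xi> x = 0"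
proof -
  have nz: "\<nu> x \<bullet> cross3 (pd_u \<nu> x) (pd_v \<nu> x) \<noteq> 0" if "x \<in> U" for x
    using conormal_graph_immersion_det[OF U that K] K[OF that] by (simp add: \<nu>_def)
  have \<xi>: "\<xi> x = inverse (\<nu> x \<bullet> cross3 (pd_u \<nu> x) (pd_v \<nu> x)) *\<^sub>R cross3 (pd_u \<nu> x) (pd_v \<nu> x)"
    if "x \<in> U" for x
    unfolding \<xi>_def affine_normal_def \<nu>_def[symmetric] by (rule THE_dual_vector[OF nz[OF that]])
  then show "x \<in> U \<Longrightarrow> pd_u \<nu> x \<bullet> \<xi> x = 0" "x \<in> U \<Longrightarrow> pd_v \<nu> x \<bullet> \<xi> x = 0"
    by (simp_all add: dot_cross_self)
  have "smooth_on \<nu> U"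
    unfolding \<nu>_def by (rule smooth_on_conormal_graph_immersion[OF U K])
  then have "smooth_on (\<lambda>x. inverse (\<nu> x \<bullet> cross3 (pd_u \<nu> x) (pd_v \<nu> x)) *\<^sub>R cross3 (pd_u \<nu> x) (pd_v \<nu> x)) U"
    using U nz by (intro smooth_on_intros smooth_on_inverse)
  then show "smooth_on \<xi> U"
    using smooth_on_cong[OF U(1), of "\<lambda>x. inverse (\<nu> x \<bullet> cross3 (pd_u \<nu> x) (pd_v \<nu> x)) *\<^sub>R cross3 (pd_u \<nu> x) (pd_v \<nu> x)" \<xi>]
      \<xi> by simp
qed

section \<open>The 1-jet of the asymptotic form at a flat umbilic\<close>

lemma flat_affine_umbilic_imp_dir_deriv_affine_normal:
  assumes "flat_affine_umbilic (graph_immersion h) x" "h differentiable (at x)"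
  shows "dir_deriv w (affine_normal (graph_immersion h)) x = 0"
proof -
  let ?\<alpha> = "graph_immersion h"
  obtain c A where cA: "affine_shape_matrix ?\<alpha> x (mat c)" "affine_shape_matrix ?\<alpha> x A" "det A = 0"
    using assms(1) by (auto simp: flat_affine_umbilic_def affine_umbilic_def affine_parabolic_def)
  have inj: "v = w" if "dir_deriv v ?\<alpha> x = dir_deriv w ?\<alpha> x" for v w
    using arg_cong[OF that, of "\<lambda>y. y $ 1"] arg_cong[OF that, of "\<lambda>y. y $ 2"]
    by (simp add: dir_deriv_graph_immersion[OF assms(2)] vec_eq_iff forall_2)
  \<comment> \<open>The umbilic and the parabolic condition each supply a matrix of their own.
    Injectivity of the derivative of the immersion identifies them, and \<open>det (mat c)\<close>
    is the square of \<open>c\<close>.\<close>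
  have "A *v v = mat c *v v" for v
    using cA by (intro inj) (simp add: affine_shape_matrix_def dir_deriv_def)
  then have "A = mat c" by (simp add: matrix_eq)
  then have "c = 0" using cA(3) by (simp add: det_2 mat_def)
  then have "dir_deriv w (affine_normal ?\<alpha>) x = dir_deriv 0 ?\<alpha> x"
    using cA(1) by (simp add: affine_shape_matrix_def dir_deriv_def)
  also have "\<dots> = 0"
    using linear_0[OF linear_dir_deriv[OF assms(2)]]
    by (simp add: dir_deriv_graph_immersion[OF assms(2)] vec_eq_iff forall_3)
  finally show ?thesis .
qed

text \<open>Orthogonality on all of \<open>W\<close> makes the pairing equal to a second derivative
  of \<open>\<nu>\<close> against \<open>- \<xi>\<close> on \<open>W\<close>, so this may be
  differentiated once more. The product rule leaves a term with a derivative of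
  \<open>\<xi>\<close>, which vanishes at \<open>x\<close>.\<close>

lemma dir_deriv_conormal_pairing:
  fixes \<nu> \<xi> :: "'a::real_normed_vector \<Rightarrow> 'b::real_inner"
  assumes W: "open W" "x \<in> W" and s: "smooth_on \<nu> W" "smooth_on \<xi> W"
    and orth: "\<And>y. y \<in> W \<Longrightarrow> dir_deriv u \<nu> y \<bullet> \<xi> y = 0"
    and flat: "\<And>w. dir_deriv w \<xi> x = 0"
  shows "dir_deriv w (\<lambda>y. dir_deriv u \<nu> y \<bullet> dir_deriv v \<xi> y) x
    = - (dir_deriv w (dir_deriv v (dir_deriv u \<nu>)) x \<bullet> \<xi> x)"
proof -
  have D: "dir_deriv v (\<lambda>y. f y \<bullet> \<xi> y) y = f y \<bullet> dir_deriv v \<xi> y + dir_deriv v f y \<bullet> \<xi> y"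
    if "y \<in> W" "smooth_on f W" for f y v
    using that s
    by (intro dir_deriv_eq[OF has_derivative_inner] has_derivative_dir_deriv smooth_on_imp_differentiable[of _ W])
  have eq: "dir_deriv u \<nu> y \<bullet> dir_deriv v \<xi> y = - (dir_deriv v (dir_deriv u \<nu>) y \<bullet> \<xi> y)" if "y \<in> W" for y
  proof -
    have "0 = dir_deriv v (\<lambda>y. 0::real) y" by (simp add: dir_deriv_def)
    also have "\<dots> = dir_deriv v (\<lambda>y. dir_deriv u \<nu> y \<bullet> \<xi> y) y"
      using W(1) that orth by (intro dir_deriv_cong[of _ y W]) auto
    finally show ?thesis using D[OF that smooth_on_dir_deriv[OF s(1)]] by simp
  qed
  have "smooth_on (\<lambda>y. dir_deriv u \<nu> y \<bullet> dir_deriv v \<xi> y) W"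
    using W s by (intro smooth_on_intros)
  then have "dir_deriv w (\<lambda>y. dir_deriv u \<nu> y \<bullet> dir_deriv v \<xi> y) x
      = dir_deriv w (\<lambda>y. - (dir_deriv v (dir_deriv u \<nu>) y \<bullet> \<xi> y)) x"
    using W eq by (intro dir_deriv_cong[of _ x W] smooth_on_imp_differentiable[of _ W])
  also have "\<dots> = - dir_deriv w (\<lambda>y. dir_deriv v (dir_deriv u \<nu>) y \<bullet> \<xi> y) x"
    using W s
    by (intro dir_deriv_eq[OF has_derivative_minus] has_derivative_dir_deriv
        smooth_on_imp_differentiable[of _ W] smooth_on_intros)
  also have "\<dots> = - (dir_deriv w (dir_deriv v (dir_deriv u \<nu>)) x \<bullet> \<xi> x)"
    using D[OF W(2) smooth_on_dir_deriv[OF smooth_on_dir_deriv[OF s(1)]]] flat by simp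
  finally show ?thesis .
qed

text \<open>At 0 neither the cubic terms nor the remainder contribute to second derivatives, so the
  Hessian is diagonal with entries 1 and \<open>\<epsilon>\<close>.\<close>

lemma hessian_det_Pick_form:
  fixes \<epsilon> \<sigma> :: real
  assumes U: "open U" "0 \<in> U" and R: "terms_of_order 4 U R"
    and h: "\<And>x. x \<in> U \<Longrightarrow> h x = 1/2 * ((x $ 1)\<^sup>2 + \<epsilon> * (x $ 2)\<^sup>2)
      + 1/6 * \<sigma> * ((x $ 1)^3 - 3 * \<epsilon> * x $ 1 * (x $ 2)\<^sup>2) + R x"
  shows "smooth_on h U" and "hessian_det h 0 = \<epsilon>"
proof -
  define q :: "real^2 \<Rightarrow> real" where "q x = 1/2 * ((x $ 1)\<^sup>2 + \<epsilon> * (x $ 2)\<^sup>2)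
      + 1/6 * \<sigma> * ((x $ 1)^3 - 3 * \<epsilon> * x $ 1 * (x $ 2)\<^sup>2)" for x
  have sR: "smooth_on R U" using R by (simp add: terms_of_order_def)
  have sq: "smooth_on q U" unfolding q_def using U(1) by (intro smooth_on_intros)
  have hq: "q x + R x = h x" if "x \<in> U" for x using h[OF that] by (simp add: q_def)
  show sh: "smooth_on h U" by (rule smooth_on_cong[OF U(1) hq smooth_on_add[OF U(1) sq sR]])
  have add: "dir_deriv w (\<lambda>x. f x + g x) x = dir_deriv w f x + dir_deriv w g x"
    if "smooth_on f U" "smooth_on g U" "x \<in> U" for f g :: "real^2 \<Rightarrow> real" and w x
    using that
    by (intro dir_deriv_eq[OF has_derivative_add] has_derivative_dir_deriv smooth_on_imp_differentiable[of _ U])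
  have D1: "dir_deriv v h x = dir_deriv v q x + dir_deriv v R x" if "x \<in> U" for v x
    using dir_deriv_cong[OF smooth_on_imp_differentiable[OF sh that] U(1) that hq[symmetric]]
      add[OF sq sR that] by simp
  have "dir_deriv w (dir_deriv v h) 0 = dir_deriv w (\<lambda>x. dir_deriv v q x + dir_deriv v R x) 0" for w v
    using smooth_on_imp_differentiable[OF smooth_on_dir_deriv[OF sh] U(2)] U D1 by (rule dir_deriv_cong)
  then have D2: "dir_deriv w (dir_deriv v h) 0 = dir_deriv w (dir_deriv v q) 0" for w v
    using add[OF smooth_on_dir_deriv[OF sq] smooth_on_dir_deriv[OF sR] U(2)]
      terms_of_order_imp_second_deriv_zero[OF U R] by simp
  note [derivative_intros] = bounded_linear.has_derivative[OF bounded_linear_vec_nth]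
  have q1: "dir_deriv v q = (\<lambda>x. x$1 * v$1 + \<epsilon> * x$2 * v$2
      + \<sigma> / 2 * ((x$1)\<^sup>2 * v$1 - \<epsilon> * (x$2)\<^sup>2 * v$1 - 2 * \<epsilon> * x$1 * x$2 * v$2))" for v
    unfolding q_def
    by (rule ext, rule dir_deriv_eq) (auto intro!: derivative_eq_intros simp: fun_eq_iff field_simps power2_eq_square)
  have q2: "dir_deriv w (dir_deriv v q) 0 = w$1 * v$1 + \<epsilon> * w$2 * v$2" for v w
    unfolding q1
    by (rule dir_deriv_eq) (auto intro!: derivative_eq_intros simp: fun_eq_iff)
  show "hessian_det h 0 = \<epsilon>"
    by (simp add: hessian_det_def pd_u_eq_dir_deriv pd_v_eq_dir_deriv D2 q2 axis_def)
qed

text \<open>The equation is matched as an equality of quadratic forms, not merely up to a factor: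
  rescaling the coordinates already makes the leading coefficients equal to those stated.\<close>

theorem proposition4p15:
  fixes U :: "(real^2) set" and h R :: "real^2 \<Rightarrow> real" and \<epsilon> \<sigma> :: real
  assumes "open U" and "0 \<in> U"
    and "\<epsilon> \<in> {1, -1}"
    and "terms_of_order 4 U R"
    and "\<And>x. x \<in> U \<Longrightarrow> h x = 1/2 * ((x $ 1)\<^sup>2 + \<epsilon> * (x $ 2)\<^sup>2)
           + 1/6 * \<sigma> * ((x $ 1)^3 - 3 * \<epsilon> * x $ 1 * (x $ 2)\<^sup>2) + R x"
    and "flat_affine_umbilic (graph_immersion h) 0"
    and "nondegenerate_critical_point (affine_parabolic_function (graph_immersion h)) 0"
  shows "\<exists>\<epsilon>\<^sub>1 V W \<phi> R\<^sub>1 R\<^sub>2 R\<^sub>3.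
    \<epsilon>\<^sub>1 \<in> {1, -1} \<and> 0 \<in> V \<and> W \<subseteq> U \<and> coordinate_change V W \<phi> \<and> \<phi> 0 = 0 \<and>
    terms_of_order 2 V R\<^sub>1 \<and> terms_of_order 2 V R\<^sub>2 \<and> terms_of_order 2 V R\<^sub>3 \<and>
    (\<forall>x\<in>V. \<forall>w. pullback_form \<phi> (affine_asymptotic_form (graph_immersion h)) x w =
       bde_form (\<lambda>x. - \<epsilon>\<^sub>1 * x $ 2 + R\<^sub>1 x) (\<lambda>x. - 2 * \<epsilon>\<^sub>1 * x $ 1 + R\<^sub>2 x) (\<lambda>x. x $ 2 + R\<^sub>3 x) x w)"
proof -
  let ?\<alpha> = "graph_immersion h"
  define \<nu> \<xi> where "\<nu> = conormal ?\<alpha>" and "\<xi> = affine_normal ?\<alpha>"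
  note sh = hessian_det_Pick_form(1)[OF assms(1,2,4,5)] and K0 = hessian_det_Pick_form(2)[OF assms(1,2,4,5)]
  \<comment> \<open>The Euclidean parabolic points are removed; the origin stays because the
    determinant there is \<open>\<epsilon>\<close>.\<close>
  define W where "W = {x \<in> U. hessian_det h x \<noteq> 0}"
  have "W = U \<inter> hessian_det h -` (- {0})" by (auto simp: W_def)
  then have oW: "open W"
    using continuous_open_preimage[OF smooth_on_imp_continuous_on[OF smooth_on_hessian_det[OF assms(1) sh]] assms(1)]
      open_Compl[OF closed_singleton] by metis
  have W0: "0 \<in> W" and WU: "W \<subseteq> U" and WK: "\<And>x. x \<in> W \<Longrightarrow> hessian_det h x \<noteq> 0"
    using assms(2,3) K0 by (auto simp: W_def)
  have sW: "smooth_on h W" using smooth_on_subset[OF sh WU] .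
  have s: "smooth_on \<nu> W" "smooth_on \<xi> W"
    unfolding \<nu>_def \<xi>_def
    using smooth_on_conormal_graph_immersion[OF oW sW WK] affine_normal_graph_immersion(1)[OF oW sW WK]
    by blast+
  have orth: "dir_deriv (axis 1 1) \<nu> x \<bullet> \<xi> x = 0" "dir_deriv (axis 2 1) \<nu> x \<bullet> \<xi> x = 0" if "x \<in> W" for x
    using affine_normal_graph_immersion(2,3)[OF oW sW WK that]
    by (simp_all add: \<nu>_def \<xi>_def pd_u_eq_dir_deriv pd_v_eq_dir_deriv)
  have flat: "dir_deriv w \<xi> 0 = 0" for w
    unfolding \<xi>_def
    using flat_affine_umbilic_imp_dir_deriv_affine_normal[OF assms(6) smooth_on_imp_differentiable[OF sW W0]] .
  have lmn: "coef_l ?\<alpha> = (\<lambda>x. dir_deriv (axis 1 1) \<nu> x \<bullet> dir_deriv (axis 1 1) \<xi> x)"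
    "coef_m ?\<alpha> = (\<lambda>x. dir_deriv (axis 1 1) \<nu> x \<bullet> dir_deriv (axis 2 1) \<xi> x)"
    "coef_n ?\<alpha> = (\<lambda>x. dir_deriv (axis 2 1) \<nu> x \<bullet> dir_deriv (axis 2 1) \<xi> x)"
    by (simp_all add: fun_eq_iff coef_l_def coef_m_def coef_n_def \<nu>_def \<xi>_def pd_u_eq_dir_deriv pd_v_eq_dir_deriv)
  have sl: "smooth_on (coef_l ?\<alpha>) W" "smooth_on (coef_m ?\<alpha>) W" "smooth_on (coef_n ?\<alpha>) W"
    unfolding lmn by (intro smooth_on_inner smooth_on_dir_deriv oW s)+
  have pair: "dir_deriv w (\<lambda>y. dir_deriv u \<nu> y \<bullet> dir_deriv v \<xi> y) 0
      = - (dir_deriv w (dir_deriv v (dir_deriv u \<nu>)) 0 \<bullet> \<xi> 0)"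
    if "u \<in> {axis 1 1, axis 2 1}" for u v w
    using that orth by (intro dir_deriv_conormal_pairing[OF oW W0 s _ flat]) auto
  have comm: "dir_deriv w (dir_deriv v f) x = dir_deriv v (dir_deriv w f) x"
    if "smooth_on f W" "x \<in> W" for f :: "real^2 \<Rightarrow> real^3" and v w x
    using dir_deriv_commute[OF oW that(2,1)] .
  have sym1: "pd_v (coef_l ?\<alpha>) 0 = pd_u (coef_m ?\<alpha>) 0"
    using comm[OF smooth_on_dir_deriv[OF s(1)] W0, of "axis 1 1" "axis 2 1"]
    by (simp add: pd_u_eq_dir_deriv pd_v_eq_dir_deriv lmn pair)
  \<comment> \<open>Here the inner two derivatives are exchanged under a further derivative, so
    commutation is used on all of \<open>W\<close>. The first symmetry exchanged only the outer two,
    at the origin.\<close>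
  have "dir_deriv (axis 2 1) (dir_deriv (axis 2 1) (dir_deriv (axis 1 1) \<nu>)) 0
      = dir_deriv (axis 2 1) (dir_deriv (axis 1 1) (dir_deriv (axis 2 1) \<nu>)) 0"
    using oW W0 s comm[OF s(1)]
    by (intro dir_deriv_cong[of _ 0 W] smooth_on_imp_differentiable[of _ W] smooth_on_dir_deriv)
  then have sym2: "pd_v (coef_m ?\<alpha>) 0 = pd_u (coef_n ?\<alpha>) 0"
    using comm[OF smooth_on_dir_deriv[OF s(1)] W0, of "axis 1 1" "axis 2 1"]
    by (simp add: pd_u_eq_dir_deriv pd_v_eq_dir_deriv lmn pair)
  have z: "coef_l ?\<alpha> 0 = 0" "coef_m ?\<alpha> 0 = 0" "coef_n ?\<alpha> 0 = 0"
    unfolding lmn by (simp_all add: flat)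
  have "nondegenerate_critical_point (\<lambda>x. coef_l ?\<alpha> x * coef_n ?\<alpha> x - (coef_m ?\<alpha> x)\<^sup>2) 0"
    using assms(7) by (simp add: affine_parabolic_function_def[abs_def])
  from bde_normal_form[OF oW W0 sl z sym1 sym2 this] WU show ?thesis
    unfolding affine_asymptotic_form_def by blast
qed

end
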